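(* Let $\{m_n:n\ge1\}$ be a sequence of positive integers and let $\mathbf M_n=(X_{n,ij})_{i\in[m_n],j\in[n]}$ be an $m_n\times n$ real random matrix whose entries are i.i.d. with common distribution $\mathcal P$ having a density $f$, zero mean and finite fourth moment. Then the problem sequence of minimizing $-\|\mathbf M_n\boldsymbol v\|_2^2$ over $\boldsymbol v\in\mathcal S_n$ (i.e. finding the top eigenvector of $\mathbf M_n^\top\mathbf M_n$) is stable under small perturbations with perturbation blocks $\mathcal J_n=\{J_{n,(i,j)}:(i,j)\in[m_n]\times[n]\}$, where $J_{n,(i,j)}=\{(i,j)\}$ for all $(i,j)\in[m_n]\times[n]$.
   Context: Parameter space: $\mathcal S_n=\{\boldsymbol v=(v_1,\dots,v_n)\in\mathbb R^n:\|\boldsymbol v\|_2=1,\ v_1\ge0\}$ with $d_n$ the Euclidean distance. The input index set is $I_n=[m_n]\times[n]$, and $\mathbf X^n=(X_{n,ij})_{(i,j)\in I_n}$. The minimizer is almost surely unique, denoted $\widehat{\boldsymbol v}(\mathbf X^n)$. $[k]=\{1,\dots,k\}$. Stability. $\mathcal J_n=\{J_{n,l}:l\in\mathcal L_n\}$ is a finite family of subsets of $I_n$ with union $I_n$; its number of blocks is $\operatorname{card}(\mathcal L_n)$. For each $l$, $\mathbf X^{n,l}$ is an independent copy of $\mathbf X^n$ (no further assumption on the joint law over $l$), and $\mathbf X^n_l$ is $\mathbf X^n$ with the coordinates in $J_{n,l}$ replaced by those of $\mathbf X^{n,l}$. For a metric $\mathsf d$, $P(T,\mathsf d,\varepsilon)$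 is the largest cardinality of a subset of $T$ with pairwise distances $>\varepsilon$. With $\mathcal O_{n,A}=\{\widehat{\boldsymbol v}(\mathbf X^n_l):l\in A\}$, the sequence is stable under small perturbations with perturbation blocks $\mathcal J_n$ if for any $\varepsilon,\delta>0$ there is $M(\varepsilon,\delta)<\infty$ with $\limsup_{n\to\infty}\mathbb P[\min_{A\subseteq\mathcal L_n:|A|>(1-\varepsilon)\operatorname{card}(\mathcal L_n)}P(\mathcal O_{n,A},d_n,\varepsilon)\ge M(\varepsilon,\delta)]\le\delta$. *)

theory Defs
  imports "HOL-Probability.Probability"
begin

text \<open>
  Since the dimensions vary with \<open>n\<close>, a vector of \<open>\<real>\<^sup>n\<close> is a function
  \<open>nat \<Rightarrow> real\<close> that is extensional on \<open>{1..n}\<close>, and an \<open>m \<times> n\<close> matrix is a function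
  \<open>nat \<times> nat \<Rightarrow> real\<close> on the index set \<open>{1..m} \<times> {1..n}\<close>.
\<close>

definition half_sphere :: "nat \<Rightarrow> (nat \<Rightarrow> real) set" where
  "half_sphere n = {v \<in> extensional {1..n}. L2_set v {1..n} = 1 \<and> 0 \<le> v 1}"

definition euclid_dist :: "nat \<Rightarrow> (nat \<Rightarrow> real) \<Rightarrow> (nat \<Rightarrow> real) \<Rightarrow> real" where
  "euclid_dist n v w = L2_set (\<lambda>j. v j - w j) {1..n}"

definition mat_vec :: "nat \<Rightarrow> (nat \<times> nat \<Rightarrow> real) \<Rightarrow> (nat \<Rightarrow> real) \<Rightarrow> nat \<Rightarrow> real" where
  "mat_vec n x v = (\<lambda>i. \<Sum>j=1..n. x (i, j) * v j)"

definition objective :: "nat \<Rightarrow> nat \<Rightarrow> (nat \<times> nat \<Rightarrow> real) \<Rightarrow> (nat \<Rightarrow> real) \<Rightarrow> real" where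
  "objective m n x v = - (L2_set (mat_vec n x v) {1..m})\<^sup>2"

text \<open>
  For matrices with several minimizers (a null event for the random matrices considered),
  an arbitrary one of them is chosen.
\<close>

definition minimizer :: "nat \<Rightarrow> nat \<Rightarrow> (nat \<times> nat \<Rightarrow> real) \<Rightarrow> nat \<Rightarrow> real" where
  "minimizer m n x = arg_min_on (objective m n x) (half_sphere n)"

text \<open>The supremum makes the packing number \<open>\<infinity>\<close> when packings are arbitrarily large.\<close>

definition packing_number :: "'v set \<Rightarrow> ('v \<Rightarrow> 'v \<Rightarrow> real) \<Rightarrow> real \<Rightarrow> enat" where
  "packing_number T d \<epsilon> =
     (SUP S \<in> {S. finite S \<and> S \<subseteq> T \<and> pairwise (\<lambda>x y. d x y > \<epsilon>) S}. enat (card S))"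

definition independent_copy ::
  "'w measure \<Rightarrow> 'b measure \<Rightarrow> ('w \<Rightarrow> 'b) \<Rightarrow> ('w \<Rightarrow> 'b) \<Rightarrow> bool" where
  "independent_copy \<Omega> N X Y \<longleftrightarrow>
     prob_space.indep_var \<Omega> N X N Y \<and> distr \<Omega> N Y = distr \<Omega> N X"

definition perturbation_blocks :: "'k set \<Rightarrow> 'l set \<Rightarrow> ('l \<Rightarrow> 'k set) \<Rightarrow> bool" where
  "perturbation_blocks I L J \<longleftrightarrow> finite L \<and> (\<Union>l\<in>L. J l) = I"

text \<open>
  For each \<open>n\<close>, the input is \<open>X n\<close>, the copies are \<open>X' n l\<close> for \<open>l \<in> L n\<close>, all defined on the
  probability space \<open>\<Omega> n\<close>; \<open>sol n\<close> maps an input to the solution of the \<open>n\<close>-th problem, and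
  \<open>d n\<close> is the metric on the parameter space. The value of \<open>sol n\<close> on ties need not be
  measurable in the input, so the probability is taken as an outer probability, which agrees with
  the probability on measurable events and is insensitive to null events.
\<close>

definition stable_under_small_perturbations ::
  "(nat \<Rightarrow> 'w measure) \<Rightarrow> (nat \<Rightarrow> 'k set) \<Rightarrow> (nat \<Rightarrow> 'l set) \<Rightarrow> (nat \<Rightarrow> 'l \<Rightarrow> 'k set) \<Rightarrow>
   (nat \<Rightarrow> 'w \<Rightarrow> 'k \<Rightarrow> real) \<Rightarrow> (nat \<Rightarrow> 'l \<Rightarrow> 'w \<Rightarrow> 'k \<Rightarrow> real) \<Rightarrow>
   (nat \<Rightarrow> ('k \<Rightarrow> real) \<Rightarrow> 'v) \<Rightarrow> (nat \<Rightarrow> 'v \<Rightarrow> 'v \<Rightarrow> real) \<Rightarrow> bool" where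
  "stable_under_small_perturbations \<Omega> I L J X X' sol d \<longleftrightarrow>
     (\<forall>n\<ge>1. perturbation_blocks (I n) (L n) (J n)) \<and>
     (\<forall>\<epsilon>>0. \<forall>\<delta>>0. \<exists>M::nat.
        limsup (\<lambda>n. outer_measure_of (\<Omega> n)
          {\<omega> \<in> space (\<Omega> n).
             (MIN A \<in> {A. A \<subseteq> L n \<and> real (card A) > (1 - \<epsilon>) * real (card (L n))}.
                packing_number
                  ((\<lambda>l. sol n (override_on (X n \<omega>) (X' n l \<omega>) (J n l))) ` A) (d n) \<epsilon>)
             \<ge> enat M})
        \<le> ennreal \<delta>)"

end

theory Submission
  imports Defs
begin

text \<open>
  Write \<open>F x\<close> for the largest eigenvalue of \<open>x\<^sup>T x\<close>. As a function of a single entry, \<open>F\<close> is convex,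
  and \<open>2 (x v)\<^sub>i v\<^sub>j\<close> is a subgradient if \<open>v\<close> is a top eigenvector. Hence the top eigenvector \<open>w\<close> of a
  matrix \<open>y\<close> obtained from \<open>x\<close> by changing one entry by \<open>\<Delta>\<close> satisfies \<open>\<parallel>x w\<parallel>\<^sup>2 \<ge> F x - loss\<close>, where the loss is
  at most \<open>\<bar>\<Delta>\<bar>\<close> times the sum of the absolute values of the slopes at \<open>x\<close> and at \<open>y\<close>. The squares of all slopes
  at \<open>x\<close> add up to \<open>4 F x\<close>, and exchanging the old and the new value of an entry turns slopes at \<open>y\<close>
  into slopes at \<open>x\<close>; so the average loss is of order \<open>(E F / (m n))\<^sup>1\<^sup>/\<^sup>2\<close>, which tends to \<open>0\<close> as \<open>m\<close> and
  \<open>n\<close> tend to infinity, by a bound on \<open>E trace (x\<^sup>T x)\<^sup>2\<close> that uses the fourth moment.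

  On the other hand, if \<open>x'\<close> arises from \<open>x\<close> by deleting \<open>k\<close> rows, then testing \<open>x\<close> against the top
  eigenvector of \<open>x'\<close>, which is independent of these rows, gives \<open>F x - F x' \<ge> k \<sigma>\<^sup>2 / 2\<close> with
  probability \<open>1 - O(1 / k)\<close>, by Chebyshev's inequality. All but \<open>k\<close> eigenvalues of \<open>x\<^sup>T x\<close> are at most
  \<open>F x'\<close>. So for most entries the perturbed optimum is close to a space of dimension \<open>k\<close>, in which the
  unit ball has bounded packing numbers.
\<close>

section \<open>The top eigenvalue and its subgradients\<close>

definition sqnorm :: "nat \<Rightarrow> (nat \<Rightarrow> real) \<Rightarrow> real" where
  "sqnorm n u = (\<Sum>j=1..n. (u j)\<^sup>2)"

definition energy :: "nat \<Rightarrow> nat \<Rightarrow> (nat \<times> nat \<Rightarrow> real) \<Rightarrow> (nat \<Rightarrow> real) \<Rightarrow> real" where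
  "energy m n x u = (\<Sum>i=1..m. (\<Sum>j=1..n. x (i, j) * u j)\<^sup>2)"

text \<open>This is \<open>F\<close> of the overview. Evaluating at the chosen minimizer makes
  attainment hold by definition; maximality comes from \<open>minimizer_arg_min\<close>.\<close>

definition top_energy :: "nat \<Rightarrow> nat \<Rightarrow> (nat \<times> nat \<Rightarrow> real) \<Rightarrow> real" where
  "top_energy m n x = energy m n x (minimizer m n x)"

lemma sqnorm_nonneg: "0 \<le> sqnorm n u"
  by (simp add: sqnorm_def sum_nonneg)

lemma energy_nonneg: "0 \<le> energy m n x u"
  by (simp add: energy_def sum_nonneg)

lemma sqnorm_eq_L2_set: "sqnorm n u = (L2_set u {1..n})\<^sup>2"
  by (simp add: sqnorm_def L2_set_def sum_nonneg)

lemma objective_eq_energy: "objective m n x v = - energy m n x v"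
  by (simp add: objective_def energy_def mat_vec_def L2_set_def sum_nonneg)

lemma sqnorm_scale: "sqnorm n (\<lambda>j. c * u j) = c\<^sup>2 * sqnorm n u"
  by (simp add: sqnorm_def power_mult_distrib sum_distrib_left)

lemma energy_scale: "energy m n x (\<lambda>j. c * u j) = c\<^sup>2 * energy m n x u"
proof -
  have "(\<Sum>j=1..n. x (i, j) * (c * u j)) = c * (\<Sum>j=1..n. x (i, j) * u j)" for i
    unfolding sum_distrib_left by (simp add: mult_ac)
  then show ?thesis
    unfolding energy_def by (simp only: power_mult_distrib) (simp only: sum_distrib_left)
qed

lemma energy_cong:
  assumes "\<And>j. j \<in> {1..n} \<Longrightarrow> u j = w j" shows "energy m n x u = energy m n x w"
  using assms by (simp add: energy_def)

lemma sqnorm_cong: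
  assumes "\<And>j. j \<in> {1..n} \<Longrightarrow> u j = w j" shows "sqnorm n u = sqnorm n w"
  using assms by (simp add: sqnorm_def)

lemma continuous_energy: "continuous_on S (energy m n x)"
  unfolding energy_def
  by (intro continuous_intros continuous_on_product_coordinates[THEN continuous_on_subset]) auto

lemma continuous_sqnorm: "continuous_on S (sqnorm n)"
  unfolding sqnorm_def
  by (intro continuous_intros continuous_on_product_coordinates[THEN continuous_on_subset]) auto

section \<open>Existence of minimizers on the half sphere\<close>

lemma half_sphere_iff: "v \<in> half_sphere n \<longleftrightarrow> v \<in> extensional {1..n} \<and> sqnorm n v = 1 \<and> 0 \<le> v 1"
proof -
  have "L2_set v {1..n} = 1 \<longleftrightarrow> sqnorm n v = 1"
    unfolding L2_set_def sqnorm_def by (metis real_sqrt_eq_1_iff)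
  then show ?thesis by (simp add: half_sphere_def)
qed

text \<open>The topology is the product topology on all functions on \<open>nat\<close>. The unit
  norm confines the coordinates in \<open>{1..n}\<close> to \<open>{-1..1}\<close> and
  extensionality pins all others to \<open>undefined\<close>, so Tychonoff's theorem gives a compact
  box \<open>B\<close>; the remaining conditions are closed.\<close>

lemma compact_half_sphere:
  "compact (half_sphere n)"
proof -
  define B where "B = Pi\<^sub>E UNIV (\<lambda>j. if j \<in> {1..n} then {-1..1::real} else {undefined})"
  have "compactin (product_topology (\<lambda>_::nat. euclidean) UNIV) B"
    unfolding B_def compactin_PiE by auto
  then have cB: "compact B"
    by (simp add: euclidean_product_topology compactin_euclidean_iff)
  have "half_sphere n = B \<inter> ({v. sqnorm n v = 1} \<inter> {v. 0 \<le> v 1})"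
  proof (intro set_eqI iffI)
    fix v assume v: "v \<in> half_sphere n"
    have "\<bar>v j\<bar> \<le> 1" if "j \<in> {1..n}" for j
    proof -
      have "(v j)\<^sup>2 \<le> sqnorm n v"
        unfolding sqnorm_def using that by (intro member_le_sum) auto
      then have "(v j)\<^sup>2 \<le> 1" using v by (simp add: half_sphere_iff)
      then show ?thesis by (simp add: abs_square_le_1)
    qed
    then have "v \<in> B"
      using v unfolding B_def half_sphere_iff
      by (auto simp: PiE_iff extensional_def abs_le_iff minus_le_iff)
    then show "v \<in> B \<inter> ({v. sqnorm n v = 1} \<inter> {v. 0 \<le> v 1})"
      using v by (simp add: half_sphere_iff)
  next
    fix v assume v: "v \<in> B \<inter> ({v. sqnorm n v = 1} \<inter> {v. 0 \<le> v 1})"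
    then have "v \<in> B" by blast
    then have "v j \<in> (if j \<in> {1..n} then {-1..1} else {undefined})" for j
      unfolding B_def by (rule PiE_mem) simp
    then have "v j = undefined" if "j \<notin> {1..n}" for j
      using that by (metis singletonD)
    then have "v \<in> extensional {1..n}"
      by (simp add: extensional_def)
    then show "v \<in> half_sphere n" using v by (simp add: half_sphere_iff)
  qed
  moreover have "closed ({v. sqnorm n v = 1} \<inter> {v. 0 \<le> v 1})"
    by (intro closed_Int closed_Collect_eq closed_Collect_le continuous_sqnorm
        continuous_on_const continuous_on_product_coordinates)
  ultimately show ?thesis using cB compact_Int_closed by auto
qed

text \<open>The sign of \<open>c\<close> makes the first coordinate nonnegative. Since
  \<open>energy\<close> is even, restricting to half of the sphere does not change its
  maximum.\<close>

lemma half_sphere_normalize: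
  assumes "sqnorm n u > 0"
  obtains v c where "v \<in> half_sphere n" "c\<^sup>2 * sqnorm n u = 1" "\<And>j. j \<in> {1..n} \<Longrightarrow> v j = c * u j"
proof -
  define c where "c = (if u 1 \<ge> 0 then 1 else -1) / sqrt (sqnorm n u)"
  define v where "v = restrict (\<lambda>j. c * u j) {1..n}"
  have c: "c\<^sup>2 * sqnorm n u = 1"
    using assms by (simp add: c_def power_divide)
  have "sqnorm n v = 1"
    using c sqnorm_scale[of n c u] sqnorm_cong[of n v "\<lambda>j. c * u j"] by (simp add: v_def)
  moreover have "n \<ge> 1" using assms by (cases n) (auto simp: sqnorm_def)
  then have "0 \<le> v 1"
    using assms by (auto simp: v_def c_def divide_le_0_iff mult_nonneg_nonpos zero_le_mult_iff zero_le_divide_iff)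
  ultimately have "v \<in> half_sphere n" by (auto simp: half_sphere_iff v_def)
  with c show ?thesis by (intro that[of v c]) (auto simp: v_def)
qed

text \<open>\<open>arg_min_on\<close> returns a minimizer as soon as one exists; compactness of the
  half sphere provides one.\<close>

lemma minimizer_arg_min:
  assumes "n \<ge> 1"
  shows "minimizer m n x \<in> half_sphere n"
    and "w \<in> half_sphere n \<Longrightarrow> energy m n x w \<le> top_energy m n x"
proof -
  have "sqnorm n (\<lambda>_. 1) > 0" using assms by (simp add: sqnorm_def)
  then have "half_sphere n \<noteq> {}" by (metis half_sphere_normalize empty_iff)
  then obtain v where v: "v \<in> half_sphere n" "\<forall>w\<in>half_sphere n. energy m n x w \<le> energy m n x v"
    using continuous_attains_sup[OF compact_half_sphere _ continuous_energy] by metis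
  then have "is_arg_min (objective m n x) (\<lambda>w. w \<in> half_sphere n) v"
    by (auto simp: is_arg_min_def objective_eq_energy not_less)
  then have "is_arg_min (objective m n x) (\<lambda>w. w \<in> half_sphere n) (minimizer m n x)"
    unfolding minimizer_def arg_min_on_def arg_min_def by (rule someI[where P = "is_arg_min _ _"])
  then show "minimizer m n x \<in> half_sphere n"
    and "w \<in> half_sphere n \<Longrightarrow> energy m n x w \<le> top_energy m n x"
    by (auto simp: is_arg_min_def objective_eq_energy top_energy_def not_less)
qed

lemma sqnorm_minimizer: "n \<ge> 1 \<Longrightarrow> sqnorm n (minimizer m n x) = 1"
  using minimizer_arg_min(1) half_sphere_iff by blast

lemma energy_le_top:
  assumes "n \<ge> 1"
  shows "energy m n x u \<le> top_energy m n x * sqnorm n u"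
proof (cases "sqnorm n u = 0")
  case True
  then have "\<forall>j\<in>{1..n}. u j = 0" by (simp add: sqnorm_def sum_nonneg_eq_0_iff)
  then show ?thesis using True by (simp add: energy_def)
next
  case False
  then have pos: "sqnorm n u > 0" using sqnorm_nonneg[of n u] by linarith
  then obtain v c where v: "v \<in> half_sphere n" "c\<^sup>2 * sqnorm n u = 1" "\<And>j. j \<in> {1..n} \<Longrightarrow> v j = c * u j"
    using half_sphere_normalize by blast
  have "c\<^sup>2 * energy m n x u \<le> top_energy m n x"
    using minimizer_arg_min(2)[OF assms v(1)] energy_cong[OF v(3)] by (simp add: energy_scale)
  then have "c\<^sup>2 * sqnorm n u * energy m n x u \<le> top_energy m n x * sqnorm n u"
    using mult_right_mono[OF _ sqnorm_nonneg[of n u]] by (metis mult.assoc mult.commute)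
  then show ?thesis using v(2) by simp
qed

lemma top_energy_nonneg: "0 \<le> top_energy m n x"
  by (simp add: top_energy_def energy_nonneg)

text \<open>By homogeneity the test vectors need not be normalized. This turns the condition on
  \<open>u\<close> into an open one, which is what the measurability proof exploits.\<close>

lemma top_energy_less_iff:
  assumes "n \<ge> 1"
  shows "a < top_energy m n x \<longleftrightarrow> (\<exists>u. a * sqnorm n u < energy m n x u)"
proof
  assume "a < top_energy m n x"
  then show "\<exists>u. a * sqnorm n u < energy m n x u"
    using sqnorm_minimizer[OF assms] by (intro exI[of _ "minimizer m n x"]) (simp add: top_energy_def)
next
  assume "\<exists>u. a * sqnorm n u < energy m n x u"
  then obtain u where "a * sqnorm n u < energy m n x u" by blast
  also have "\<dots> \<le> top_energy m n x * sqnorm n u" by (rule energy_le_top[OF assms])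
  finally show "a < top_energy m n x"
    using sqnorm_nonneg[of n u] mult_right_mono[of "top_energy m n x" a "sqnorm n u"] by fastforce
qed

section \<open>Measurability of the top eigenvalue\<close>

lemma energy_measurable:
  "(\<lambda>x. energy m n x u) \<in> borel_measurable (PiM ({1..m} \<times> {1..n}) (\<lambda>_. borel))"
  unfolding energy_def by measurable

text \<open>For fixed \<open>x\<close> the vectors witnessing \<open>a < top_energy m n x\<close>
  form an open set, which meets a countable dense set \<open>D\<close> if it is nonempty. Superlevel
  sets are therefore countable unions of measurable sets, and no measurable choice of an eigenvector
  is involved.\<close>

lemma top_energy_measurable:
  assumes n: "n \<ge> 1"
  shows "top_energy m n \<in> borel_measurable (PiM ({1..m} \<times> {1..n}) (\<lambda>_. borel))"
proof (rule borel_measurableI_greater)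
  let ?N = "PiM ({1..m} \<times> {1..n}) (\<lambda>_. borel) :: (nat \<times> nat \<Rightarrow> real) measure"
  fix a :: real
  obtain D :: "(nat \<Rightarrow> real) set"
    where D: "countable D" "\<And>U. open U \<Longrightarrow> U \<noteq> {} \<Longrightarrow> \<exists>d\<in>D. d \<in> U"
    using countable_dense_exists by blast
  have "a < top_energy m n x \<longleftrightarrow> (\<exists>u\<in>D. a * sqnorm n u < energy m n x u)" for x
  proof -
    have "open {u. a * sqnorm n u < energy m n x u}"
      by (intro open_Collect_less continuous_intros continuous_energy continuous_sqnorm)
    then show ?thesis
      using D(2) unfolding top_energy_less_iff[OF n] by blast
  qed
  then have eq: "{x \<in> space ?N. a < top_energy m n x} =
      (\<Union>u\<in>D. {x \<in> space ?N. a * sqnorm n u < energy m n x u})"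
    by auto
  show "{x \<in> space ?N. a < top_energy m n x} \<in> sets ?N"
    unfolding eq using energy_measurable D(1)
    by (intro sets.countable_UN'') (auto intro!: borel_measurable_less)
qed

section \<open>Changing a single entry\<close>

definition slope :: "nat \<Rightarrow> nat \<Rightarrow> (nat \<times> nat \<Rightarrow> real) \<Rightarrow> nat \<times> nat \<Rightarrow> real" where
  "slope m n x l = 2 * minimizer m n x (snd l) * mat_vec n x (minimizer m n x) (fst l)"

text \<open>Only the coordinate \<open>fst l\<close> of the matrix-vector product changes, namely by
  \<open>(t - x l) * u (snd l)\<close>; its square is expanded.\<close>

lemma energy_upd:
  assumes "l \<in> {1..m} \<times> {1..n}"
  shows "energy m n (x(l := t)) u = energy m n x u
     + (t - x l) * (2 * u (snd l) * mat_vec n x u (fst l)) + ((t - x l) * u (snd l))\<^sup>2"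
proof -
  obtain a b where l: "l = (a, b)" and a: "a \<in> {1..m}" and b: "b \<in> {1..n}"
    using assms by auto
  have row: "(\<Sum>j=1..n. (x(l := t)) (i, j) * u j) =
      mat_vec n x u i + (if i = a then (t - x l) * u b else 0)" for i
  proof -
    have "(\<Sum>j=1..n. (x(l := t)) (i, j) * u j) =
        (\<Sum>j=1..n. x (i, j) * u j + (if j = b then (if i = a then (t - x l) * u b else 0) else 0))"
      by (intro sum.cong) (auto simp: l algebra_simps)
    also have "\<dots> = mat_vec n x u i + (if i = a then (t - x l) * u b else 0)"
      using b by (simp add: sum.distrib mat_vec_def)
    finally show ?thesis .
  qed
  have "energy m n (x(l := t)) u =
      (\<Sum>i=1..m. (mat_vec n x u i)\<^sup>2 + (if i = a then 2 * mat_vec n x u a * ((t - x l) * u b) + ((t - x l) * u b)\<^sup>2 else 0))"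
    unfolding energy_def row by (intro sum.cong) (auto simp: power2_sum)
  also have "\<dots> = energy m n x u + (2 * mat_vec n x u a * ((t - x l) * u b) + ((t - x l) * u b)\<^sup>2)"
    using a by (simp add: sum.distrib energy_def mat_vec_def)
  finally show ?thesis by (simp add: l algebra_simps)
qed

text \<open>The old eigenvector serves as test vector for the new matrix, and the quadratic
  remainder in \<open>energy_upd\<close> is nonnegative. The argument is valid for any choice among
  several minimizers.\<close>

lemma top_energy_upd_ge:
  assumes "n \<ge> 1" "l \<in> {1..m} \<times> {1..n}"
  shows "top_energy m n (x(l := t)) \<ge> top_energy m n x + (t - x l) * slope m n x l"
proof -
  have "top_energy m n x + (t - x l) * slope m n x l \<le> energy m n (x(l := t)) (minimizer m n x)"
    unfolding energy_upd[OF assms(2)] by (simp add: top_energy_def slope_def)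
  also have "\<dots> \<le> top_energy m n (x(l := t))"
    using energy_le_top[OF assms(1)] sqnorm_minimizer[OF assms(1)] by (metis mult.right_neutral)
  finally show ?thesis .
qed

text \<open>The value of the new eigenvector is followed from the new matrix \<open>?y\<close> back
  to \<open>x\<close>, which loses a multiple of the slope at \<open>?y\<close>; the optimum at
  \<open>?y\<close> is compared with that at \<open>x\<close> by the subgradient inequality, which
  loses a multiple of the slope at \<open>x\<close>.\<close>

lemma near_optimal_minimizer_upd:
  assumes "n \<ge> 1" "l \<in> {1..m} \<times> {1..n}"
  shows "top_energy m n x - energy m n x (minimizer m n (x(l := b)))
     \<le> \<bar>b - x l\<bar> * (\<bar>slope m n x l\<bar> + \<bar>slope m n (x(l := b)) l\<bar>)"
proof -
  let ?y = "x(l := b)"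
  have "energy m n (?y(l := x l)) (minimizer m n ?y) \<ge>
      top_energy m n ?y + (x l - b) * slope m n ?y l"
    unfolding energy_upd[OF assms(2), of ?y "x l"] by (simp add: top_energy_def slope_def)
  moreover have "?y(l := x l) = x" by simp
  ultimately have "energy m n x (minimizer m n ?y) \<ge> top_energy m n ?y + (x l - b) * slope m n ?y l"
    by simp
  moreover have "top_energy m n ?y \<ge> top_energy m n x + (b - x l) * slope m n x l"
    by (rule top_energy_upd_ge[OF assms])
  moreover have "- ((b - x l) * slope m n x l) \<le> \<bar>b - x l\<bar> * \<bar>slope m n x l\<bar>"
    "- ((x l - b) * slope m n ?y l) \<le> \<bar>b - x l\<bar> * \<bar>slope m n ?y l\<bar>"
    by (metis abs_ge_minus_self abs_mult) (metis abs_ge_minus_self abs_mult abs_minus_commute)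
  ultimately show ?thesis by (simp add: distrib_left)
qed

text \<open>The matrix of slopes has rank one, so its squared Frobenius norm factors into the
  squared norms of \<open>x v\<close> and of the unit vector \<open>v\<close>.\<close>

lemma sum_slope_sq:
  assumes "n \<ge> 1"
  shows "(\<Sum>l\<in>{1..m} \<times> {1..n}. (slope m n x l)\<^sup>2) = 4 * top_energy m n x"
proof -
  let ?v = "minimizer m n x"
  have "(\<Sum>l\<in>{1..m} \<times> {1..n}. (slope m n x l)\<^sup>2) =
      (\<Sum>i=1..m. \<Sum>j=1..n. 4 * ((mat_vec n x ?v i)\<^sup>2 * (?v j)\<^sup>2))"
    by (subst sum.cartesian_product)
      (auto intro!: sum.cong simp: slope_def power_mult_distrib)
  also have "\<dots> = 4 * ((\<Sum>i=1..m. (mat_vec n x ?v i)\<^sup>2) * sqnorm n ?v)"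
    unfolding sqnorm_def sum_product by (simp only: sum_distrib_left)
  finally show ?thesis
    using sqnorm_minimizer[OF assms] by (simp add: top_energy_def energy_def mat_vec_def)
qed

text \<open>Subgradients of a convex function are monotone: the two subgradient inequalities are
  added. Monotonicity later confines the discontinuities of the slope in one entry to a countable
  set.\<close>

lemma slope_mono:
  assumes "n \<ge> 1" "l \<in> {1..m} \<times> {1..n}" "s \<le> t"
  shows "slope m n (x(l := s)) l \<le> slope m n (x(l := t)) l"
proof (cases "s = t")
  case False
  have "top_energy m n (x(l := t)) \<ge> top_energy m n (x(l := s)) + (t - s) * slope m n (x(l := s)) l"
    using top_energy_upd_ge[OF assms(1,2), of "x(l := s)" t] by simp
  moreover have "top_energy m n (x(l := s)) \<ge> top_energy m n (x(l := t)) + (s - t) * slope m n (x(l := t)) l"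
    using top_energy_upd_ge[OF assms(1,2), of "x(l := t)" s] by simp
  ultimately have "(t - s) * slope m n (x(l := s)) l \<le> (t - s) * slope m n (x(l := t)) l"
    by (simp add: algebra_simps)
  then show ?thesis using False assms(3) by simp
qed simp

section \<open>Packing numbers of near-optimal vectors\<close>

text \<open>The points are sorted by the integer part of \<open>c w / h\<close>. It takes at most
  \<open>2 * \<lceil>1 / h\<rceil> + 1\<close> values, and within one class the values of
  \<open>c\<close> differ by at most \<open>h\<close>.\<close>

lemma box_pigeonhole:
  fixes c :: "'a \<Rightarrow> real"
  assumes "finite W" "\<And>w. w \<in> W \<Longrightarrow> \<bar>c w\<bar> \<le> 1" "h > 0"
    and box: "\<And>V. V \<subseteq> W \<Longrightarrow> (\<And>w w'. w \<in> V \<Longrightarrow> w' \<in> V \<Longrightarrow> \<bar>c w - c w'\<bar> \<le> h) \<Longrightarrow> card V \<le> N"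
  shows "card W \<le> nat (2 * \<lceil>1 / h\<rceil> + 1) * N"
proof -
  define k where "k = \<lceil>1 / h\<rceil>"
  define I where "I = {-k..k}"
  define V where "V z = {w \<in> W. \<lfloor>c w / h\<rfloor> = z}" for z
  have "W \<subseteq> (\<Union>z\<in>I. V z)"
  proof
    fix w assume w: "w \<in> W"
    have "\<bar>c w / h\<bar> \<le> 1 / h"
      using assms(2)[OF w] \<open>h > 0\<close> by (simp add: divide_right_mono)
    then have "\<lfloor>c w / h\<rfloor> \<in> I" unfolding I_def k_def by (auto; linarith)
    then show "w \<in> (\<Union>z\<in>I. V z)" using w by (auto simp: V_def)
  qed
  then have "card W \<le> card (\<Union>z\<in>I. V z)"
    using assms(1) by (intro card_mono) (auto simp: V_def I_def)
  also have "\<dots> \<le> (\<Sum>z\<in>I. card (V z))"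
    by (rule card_UN_le) (simp add: I_def)
  also have "\<dots> \<le> (\<Sum>z\<in>I. N)"
  proof (rule sum_mono)
    fix z
    have "\<bar>c w - c w'\<bar> \<le> h" if "w \<in> V z" "w' \<in> V z" for w w'
    proof -
      have "\<bar>c w / h - c w' / h\<bar> \<le> 1"
        using that unfolding V_def by (simp; linarith)
      then show ?thesis
        using \<open>h > 0\<close> by (simp add: diff_divide_distrib[symmetric] pos_divide_le_eq)
    qed
    then show "card (V z) \<le> N" by (intro box) (auto simp: V_def)
  qed
  also have "\<dots> = nat (2 * k + 1) * N" by (simp add: I_def)
  finally show ?thesis by (simp add: k_def)
qed

lemma L2_set_diff_scale:
  "L2_set (\<lambda>j. x j - c * y j) S \<le> L2_set x S + \<bar>c\<bar> * L2_set y S"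
proof -
  have "L2_set (\<lambda>j. x j + (- c) * y j) S \<le> L2_set x S + L2_set (\<lambda>j. (- c) * y j) S"
    by (rule L2_set_triangle_ineq)
  also have "L2_set (\<lambda>j. (- c) * y j) S = \<bar>c\<bar> * L2_set y S"
    by (simp add: L2_set_def power_mult_distrib sum_distrib_left[symmetric] real_sqrt_mult)
  finally show ?thesis by simp
qed

text \<open>\<open>N\<close> and \<open>\<eta>\<close> are fixed before the dimension
  \<open>n\<close>, so the bound is uniform in \<open>n\<close>. \<open>V\<close> is a subspace,
  which the induction shrinks to the kernel of one functional after another; \<open>q\<close> plays
  the role of a nonnegative quadratic form, known only through a consequence of the parallelogram
  law. It controls the norm on the common kernel of the \<open>k\<close> functionals
  \<open>T i\<close>.\<close>

definition kernel_packing_bound :: "nat \<Rightarrow> real \<Rightarrow> real \<Rightarrow> real \<Rightarrow> nat \<Rightarrow> bool" where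
  "kernel_packing_bound k \<epsilon> \<rho> \<eta> N \<longleftrightarrow>
    (\<forall>n q (T :: nat \<Rightarrow> (nat \<Rightarrow> real) \<Rightarrow> real) V W.
    (\<forall>x y c. x \<in> V \<longrightarrow> y \<in> V \<longrightarrow> (\<lambda>j. x j - c * y j) \<in> V) \<longrightarrow>
    (\<forall>i x y c. T i (\<lambda>j. x j - c * y j) = T i x - c * T i y) \<longrightarrow>
    (\<forall>x y c. q (\<lambda>j. x j - c * y j) \<le> 2 * q x + 2 * c\<^sup>2 * q y) \<longrightarrow>
    (\<forall>x. 0 \<le> q x) \<longrightarrow>
    (\<forall>u\<in>V. (\<forall>i<k. T i u = 0) \<longrightarrow> sqnorm n u \<le> q u) \<longrightarrow>
    finite W \<longrightarrow> W \<subseteq> V \<longrightarrow> (\<forall>w\<in>W. L2_set w {1..n} \<le> \<rho> \<and> q w \<le> \<eta>) \<longrightarrow>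
    pairwise (\<lambda>x y. euclid_dist n x y > \<epsilon>) W \<longrightarrow> card W \<le> N)"

text \<open>
  Induction on the number of functionals: subtracting from every point a multiple (with factor at
  most 1) of the one at which the last functional is largest moves all points into the kernel of
  that functional, and the pigeonhole principle makes the multiples almost equal.
\<close>

lemma packing_bound:
  fixes \<epsilon> \<rho> :: real
  assumes "\<epsilon> > 0" "\<rho> > 0"
  shows "\<exists>N. \<exists>\<eta>>0. kernel_packing_bound k \<epsilon> \<rho> \<eta> N"
  using assms
proof (induction k arbitrary: \<epsilon> \<rho>)
  case (0 \<epsilon> \<rho>)
  show ?case
    unfolding kernel_packing_bound_def
  \<comment> \<open>Without functionals \<open>q\<close> dominates the squared norm on
    \<open>V\<close>, so two points with \<open>q\<close> at most
    \<open>\<epsilon>\<^sup>2 / 8\<close> have squared distance at most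
    \<open>\<epsilon>\<^sup>2 / 2\<close> and cannot be separated.\<close>
  proof (intro exI[of _ "1 :: nat"] exI[of _ "\<epsilon>\<^sup>2 / 8"] conjI allI impI)
    show "0 < \<epsilon>\<^sup>2 / 8" using \<open>\<epsilon> > 0\<close> by simp
  next
    fix n q and T :: "nat \<Rightarrow> (nat \<Rightarrow> real) \<Rightarrow> real" and V W
    assume V: "\<forall>x y c. x \<in> V \<longrightarrow> y \<in> V \<longrightarrow> (\<lambda>j. x j - c * y j) \<in> V"
      and q: "\<forall>x y c. q (\<lambda>j. x j - c * y j) \<le> 2 * q x + 2 * c\<^sup>2 * q y"
      and ker: "\<forall>u\<in>V. (\<forall>i<0. T i u = 0) \<longrightarrow> sqnorm n u \<le> q u"
      and W: "finite W" "W \<subseteq> V" "\<forall>w\<in>W. L2_set w {1..n} \<le> \<rho> \<and> q w \<le> \<epsilon>\<^sup>2 / 8"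
      and sep: "pairwise (\<lambda>x y. euclid_dist n x y > \<epsilon>) W"
    have "w = w'" if w: "w \<in> W" "w' \<in> W" for w w'
    proof (rule ccontr)
      assume "w \<noteq> w'"
      then have "\<epsilon> < euclid_dist n w w'" using sep w by (auto simp: pairwise_def)
      then have "\<epsilon>\<^sup>2 < (euclid_dist n w w')\<^sup>2" using \<open>\<epsilon> > 0\<close> by (simp add: power_strict_mono)
      also have "\<dots> = sqnorm n (\<lambda>j. w j - 1 * w' j)"
        by (simp add: euclid_dist_def sqnorm_eq_L2_set)
      also have "\<dots> \<le> q (\<lambda>j. w j - 1 * w' j)" using ker V w W(2) by blast
      also have "\<dots> \<le> 2 * q w + 2 * 1\<^sup>2 * q w'" using q by blast
      also have "\<dots> \<le> \<epsilon>\<^sup>2 / 2" using W(3)[rule_format, OF w(1)] W(3)[rule_format, OF w(2)] by simp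
      finally show False using \<open>\<epsilon> > 0\<close> by simp
    qed
    then show "card W \<le> 1" using W(1) by (metis One_nat_def card_le_Suc0_iff_eq)
  qed
next
  case (Suc k \<epsilon> \<rho>)
  \<comment> \<open>Moving the points into the kernel costs at most
    \<open>h * \<rho> = \<epsilon> / 2\<close> of the separation of points with nearly equal
    multiples, at most doubles the norm bound, and multiplies the bound on \<open>q\<close> by at
    most 4; hence the parameters here and \<open>\<eta> / 4\<close> below.\<close>
  from Suc.IH[of "\<epsilon> / 2" "2 * \<rho>"] Suc.prems obtain N \<eta> where \<eta>: "\<eta> > 0"
    and IH: "kernel_packing_bound k (\<epsilon> / 2) (2 * \<rho>) \<eta> N"
    by auto
  define h where "h = \<epsilon> / (2 * \<rho>)"
  have h: "h > 0" using Suc.prems by (simp add: h_def)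
  show ?case
    unfolding kernel_packing_bound_def
  proof (intro exI[of _ "nat (2 * \<lceil>1 / h\<rceil> + 1) * N"] exI[of _ "\<eta> / 4"] conjI allI impI)
    show "0 < \<eta> / 4" using \<eta> by simp
  next
    fix n q and T :: "nat \<Rightarrow> (nat \<Rightarrow> real) \<Rightarrow> real" and V W
    assume V: "\<forall>x y c. x \<in> V \<longrightarrow> y \<in> V \<longrightarrow> (\<lambda>j. x j - c * y j) \<in> V"
      and T: "\<forall>i x y c. T i (\<lambda>j. x j - c * y j) = T i x - c * T i y"
      and q: "\<forall>x y c. q (\<lambda>j. x j - c * y j) \<le> 2 * q x + 2 * c\<^sup>2 * q y"
      and q0: "\<forall>x. 0 \<le> q x"
      and ker: "\<forall>u\<in>V. (\<forall>i<Suc k. T i u = 0) \<longrightarrow> sqnorm n u \<le> q u"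
      and W: "finite W" "W \<subseteq> V" "\<forall>w\<in>W. L2_set w {1..n} \<le> \<rho> \<and> q w \<le> \<eta> / 4"
      and sep: "pairwise (\<lambda>x y. euclid_dist n x y > \<epsilon>) W"
    define V' where "V' = {u \<in> V. T k u = 0}"
    show "card W \<le> nat (2 * \<lceil>1 / h\<rceil> + 1) * N"
    proof (cases "W = {}")
      case False
      then have "Max ((\<lambda>w. \<bar>T k w\<bar>) ` W) \<in> (\<lambda>w. \<bar>T k w\<bar>) ` W"
        using W(1) by (intro Max_in) auto
      then obtain w0 where w0: "w0 \<in> W" and Max_eq: "Max ((\<lambda>w. \<bar>T k w\<bar>) ` W) = \<bar>T k w0\<bar>"
        by blast
      have max: "\<bar>T k w\<bar> \<le> \<bar>T k w0\<bar>" if "w \<in> W" for w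
        unfolding Max_eq[symmetric] using W(1) that by (intro Max_ge) auto
      \<comment> \<open>If \<open>T k w0 = 0\<close>, then by maximality \<open>T k\<close> vanishes
        on all of \<open>W\<close>; division by zero gives \<open>c w = 0\<close>, and the points
        are left where they are.\<close>
      define c where "c w = T k w / T k w0" for w
      have c1: "\<bar>c w\<bar> \<le> 1" if "w \<in> W" for w
        using max[OF that] by (simp add: c_def abs_divide divide_le_eq_1)
      have Tc: "T k w - c w * T k w0 = 0" if "w \<in> W" for w
        using max[OF that] by (auto simp: c_def)
      define p where "p w = (\<lambda>j. w j - c w * w0 j)" for w
      show ?thesis
      proof (rule box_pigeonhole[where c = c])
        fix U assume U: "U \<subseteq> W" and near: "\<And>w w'. w \<in> U \<Longrightarrow> w' \<in> U \<Longrightarrow> \<bar>c w - c w'\<bar> \<le> h"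
        have far: "euclid_dist n (p w) (p w') > \<epsilon> / 2" if w: "w \<in> U" "w' \<in> U" "w \<noteq> w'" for w w'
        proof -
          \<comment> \<open>The points \<open>w\<close> and \<open>w'\<close> differ by the
            difference of their projections up to a multiple of \<open>w0\<close> whose factor is at
            most \<open>h\<close>, so most of their separation survives.\<close>
          have eq: "(\<lambda>j. w j - w' j) = (\<lambda>j. (p w j - p w' j) - (c w' - c w) * w0 j)"
            by (simp only: p_def fun_eq_iff) (simp add: left_diff_distrib)
          have "euclid_dist n w w' \<le> euclid_dist n (p w) (p w') + \<bar>c w' - c w\<bar> * L2_set w0 {1..n}"
            unfolding euclid_dist_def eq by (rule L2_set_diff_scale)
          also have "\<bar>c w' - c w\<bar> * L2_set w0 {1..n} \<le> h * \<rho>"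
            using near[OF w(2,1)] W(3) w0 h by (intro mult_mono) auto
          also have "h * \<rho> = \<epsilon> / 2" using Suc.prems by (simp add: h_def)
          finally show ?thesis
            using sep w U by (force simp: pairwise_def)
        qed
        have "inj_on p U"
        proof (rule inj_onI, rule ccontr)
          fix w w' assume *: "w \<in> U" "w' \<in> U" "p w = p w'" "w \<noteq> w'"
          have "euclid_dist n (p w') (p w') = 0" by (simp add: euclid_dist_def L2_set_def)
          then show False using far[OF *(1,2,4)] *(3) Suc.prems by simp
        qed
        then have "card U = card (p ` U)" by (simp add: card_image)
        also have "\<dots> \<le> N"
        proof (rule IH[unfolded kernel_packing_bound_def, rule_format, of V' T q n])
          show "(\<lambda>j. x j - c * y j) \<in> V'" if "x \<in> V'" "y \<in> V'" for x y c
          proof -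
            have "(\<lambda>j. x j - c * y j) \<in> V" using V that unfolding V'_def by blast
            moreover have "T k (\<lambda>j. x j - c * y j) = T k x - c * T k y" using T by blast
            ultimately show ?thesis using that by (simp add: V'_def)
          qed
          show "sqnorm n u \<le> q u" if "u \<in> V'" "\<And>i. i < k \<Longrightarrow> T i u = 0" for u
            using ker that by (auto simp: V'_def less_Suc_eq)
          show "finite (p ` U)" using U W(1) finite_subset by blast
          show "p ` U \<subseteq> V'"
          proof
            fix w' assume "w' \<in> p ` U"
            then obtain w where w': "w' = p w" and w: "w \<in> W" using U by blast
            have "p w \<in> V" unfolding p_def using V w w0 W(2) by blast
            moreover have "T k (p w) = T k w - c w * T k w0" unfolding p_def using T by blast
            ultimately show "w' \<in> V'" using Tc[OF w] by (simp add: V'_def w')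
          qed
          show "L2_set w' {1..n} \<le> 2 * \<rho> \<and> q w' \<le> \<eta>" if "w' \<in> p ` U" for w'
          proof -
            from that obtain w where w': "w' = p w" and w: "w \<in> W" using U by blast
            have "L2_set (p w) {1..n} \<le> L2_set w {1..n} + \<bar>c w\<bar> * L2_set w0 {1..n}"
              unfolding p_def by (rule L2_set_diff_scale)
            also have "\<dots> \<le> \<rho> + 1 * \<rho>"
              using c1[OF w] W(3) w w0 by (intro add_mono mult_mono) auto
            finally have 1: "L2_set (p w) {1..n} \<le> 2 * \<rho>" by simp
            have "q (p w) \<le> 2 * q w + 2 * (c w)\<^sup>2 * q w0" unfolding p_def using q by blast
            also have "\<dots> \<le> 2 * (\<eta> / 4) + 2 * 1 * (\<eta> / 4)"
              using c1[OF w] W(3) w w0 q0 by (intro add_mono mult_mono) (auto simp: abs_square_le_1)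
            finally show ?thesis using 1 by (simp add: w')
          qed
          show "pairwise (\<lambda>x y. euclid_dist n x y > \<epsilon> / 2) (p ` U)"
            using far by (auto simp: pairwise_def)
        qed (use T q q0 in blast)+
        finally show "card U \<le> N" .
      qed (use W(1) c1 h in auto)
    qed simp
  qed
qed

section \<open>From an eigenvalue gap to a packing bound\<close>

lemma packing_number_le:
  assumes "\<And>S. finite S \<Longrightarrow> S \<subseteq> T \<Longrightarrow> pairwise (\<lambda>x y. d x y > \<epsilon>) S \<Longrightarrow> card S \<le> N"
  shows "packing_number T d \<epsilon> \<le> enat N"
  unfolding packing_number_def by (rule SUP_least) (use assms in auto)

text \<open>The gap \<open>top_energy m n x * sqnorm n u - energy m n x u\<close> is a nonnegative
  quadratic form in \<open>u\<close>. The claim is its parallelogram law with the term for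
  \<open>u + c w\<close> dropped; it supplies the hypothesis on \<open>q\<close> in
  \<open>kernel_packing_bound\<close>.\<close>

lemma rayleigh_gap_diff_scale:
  assumes "n \<ge> 1"
  shows "top_energy m n x * sqnorm n (\<lambda>j. u j - c * w j) - energy m n x (\<lambda>j. u j - c * w j)
    \<le> 2 * (top_energy m n x * sqnorm n u - energy m n x u)
      + 2 * c\<^sup>2 * (top_energy m n x * sqnorm n w - energy m n x w)"
proof -
  have 1: "sqnorm n (\<lambda>j. u j - c * w j) + sqnorm n (\<lambda>j. u j + c * w j) = 2 * sqnorm n u + 2 * c\<^sup>2 * sqnorm n w"
    unfolding sqnorm_def sum_distrib_left sum.distrib[symmetric]
    by (intro sum.cong) (auto simp: power2_eq_square algebra_simps)
  have "energy m n x (\<lambda>j. u j - c * w j) + energy m n x (\<lambda>j. u j + c * w j) =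
      (\<Sum>i=1..m. 2 * (\<Sum>j=1..n. x (i, j) * u j)\<^sup>2 + 2 * c\<^sup>2 * (\<Sum>j=1..n. x (i, j) * w j)\<^sup>2)"
    unfolding energy_def sum.distrib[symmetric]
  proof (rule sum.cong)
    fix i
    have "(\<Sum>j=1..n. x (i, j) * (u j - c * w j)) = (\<Sum>j=1..n. x (i, j) * u j) - c * (\<Sum>j=1..n. x (i, j) * w j)"
      "(\<Sum>j=1..n. x (i, j) * (u j + c * w j)) = (\<Sum>j=1..n. x (i, j) * u j) + c * (\<Sum>j=1..n. x (i, j) * w j)"
      unfolding sum_distrib_left sum_subtractf[symmetric] sum.distrib[symmetric]
      by (auto intro!: sum.cong simp only: right_diff_distrib distrib_left mult.left_commute)
    then show "(\<Sum>j=1..n. x (i, j) * (u j - c * w j))\<^sup>2 + (\<Sum>j=1..n. x (i, j) * (u j + c * w j))\<^sup>2 =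
        2 * (\<Sum>j=1..n. x (i, j) * u j)\<^sup>2 + 2 * c\<^sup>2 * (\<Sum>j=1..n. x (i, j) * w j)\<^sup>2"
      by (simp only: power2_sum power2_diff power_mult_distrib)
  qed simp
  then have 2: "energy m n x (\<lambda>j. u j - c * w j) + energy m n x (\<lambda>j. u j + c * w j) =
      2 * energy m n x u + 2 * c\<^sup>2 * energy m n x w"
    unfolding energy_def by (simp add: sum.distrib sum_distrib_left)
  have "energy m n x (\<lambda>j. u j + c * w j) \<le> top_energy m n x * sqnorm n (\<lambda>j. u j + c * w j)"
    by (rule energy_le_top[OF assms])
  then have "top_energy m n x * sqnorm n (\<lambda>j. u j - c * w j) - energy m n x (\<lambda>j. u j - c * w j)
    \<le> top_energy m n x * (sqnorm n (\<lambda>j. u j - c * w j) + sqnorm n (\<lambda>j. u j + c * w j))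
      - (energy m n x (\<lambda>j. u j - c * w j) + energy m n x (\<lambda>j. u j + c * w j))"
    by (simp add: algebra_simps)
  also have "\<dots> = 2 * (top_energy m n x * sqnorm n u - energy m n x u)
      + 2 * c\<^sup>2 * (top_energy m n x * sqnorm n w - energy m n x w)"
    unfolding 1 2 by (simp add: algebra_simps)
  finally show ?thesis .
qed

text \<open>Rows are set to zero instead of being removed, so that the result has the same shape and
  can be fed to \<open>top_energy m n\<close>.\<close>

definition drop_rows :: "nat \<Rightarrow> (nat \<times> nat \<Rightarrow> real) \<Rightarrow> nat \<times> nat \<Rightarrow> real" where
  "drop_rows k x = (\<lambda>l. if fst l \<le> k then 0 else x l)"

lemma energy_drop_rows:
  assumes "k \<le> m"
  shows "energy m n x u = energy m n (drop_rows k x) u + energy k n x u"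
proof -
  have "energy m n x u = (\<Sum>i=1..m. (\<Sum>j=1..n. drop_rows k x (i, j) * u j)\<^sup>2 +
      (if i \<in> {1..k} then (\<Sum>j=1..n. x (i, j) * u j)\<^sup>2 else 0))"
    unfolding energy_def by (intro sum.cong) (auto simp: drop_rows_def)
  also have "\<dots> = energy m n (drop_rows k x) u + (\<Sum>i\<in>{1..m} \<inter> {1..k}. (\<Sum>j=1..n. x (i, j) * u j)\<^sup>2)"
    by (simp only: sum.distrib energy_def sum.inter_restrict[OF finite_atLeastAtMost])
  also have "{1..m} \<inter> {1..k} = {1..k}" using assms by auto
  finally show ?thesis by (simp add: energy_def)
qed

text \<open>
  Removing \<open>k\<close> rows from the matrix lowers the top eigenvalue at least as far as the eigenvalue of
  index \<open>k + 1\<close>, so a drop of size \<open>g\<close> confines the near-optimal vectors to the neighbourhood of a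
  space of dimension \<open>k\<close>.
\<close>

lemma near_optimal_packing_bound:
  assumes "\<epsilon> > 0"
  obtains N \<eta> where "\<eta> > 0"
    and "\<And>m n x g W. n \<ge> 1 \<Longrightarrow> k \<le> m \<Longrightarrow> g > 0 \<Longrightarrow>
      top_energy m n (drop_rows k x) + g \<le> top_energy m n x \<Longrightarrow>
      (\<And>w. w \<in> W \<Longrightarrow> w \<in> half_sphere n \<and> top_energy m n x - energy m n x w \<le> g * \<eta>) \<Longrightarrow>
      packing_number W (euclid_dist n) \<epsilon> \<le> enat N"
proof -
  obtain N \<eta> where \<eta>: "\<eta> > 0" and bound: "kernel_packing_bound k \<epsilon> 1 \<eta> N"
    using packing_bound[OF assms, of 1 k] by auto
  show ?thesis
  proof (rule that[OF \<eta>, of N])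
    fix m n x g W
    assume n: "n \<ge> (1::nat)" and k: "k \<le> m" and g: "g > 0"
      and gap: "top_energy m n (drop_rows k x) + g \<le> top_energy m n x"
      and W: "\<And>w. w \<in> W \<Longrightarrow> w \<in> half_sphere n \<and> top_energy m n x - energy m n x w \<le> g * \<eta>"
    \<comment> \<open>The Rayleigh gap is divided by \<open>g\<close> so that it dominates
      \<open>sqnorm\<close> itself on the kernel. The functionals \<open>T i\<close> are the
      products with the deleted rows, shifted by one since rows are counted from 1.\<close>
    define q where "q u = (top_energy m n x * sqnorm n u - energy m n x u) / g" for u
    define T where "T i u = (\<Sum>j=1..n. x (Suc i, j) * u j)" for i u
    show "packing_number W (euclid_dist n) \<epsilon> \<le> enat N"
    proof (rule packing_number_le)
      fix S assume S: "finite S" "S \<subseteq> W" "pairwise (\<lambda>x y. euclid_dist n x y > \<epsilon>) S"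
      show "card S \<le> N"
      proof (rule bound[unfolded kernel_packing_bound_def, rule_format, of UNIV T q n S])
        show "T i (\<lambda>j. x j - c * y j) = T i x - c * T i y" for i x y c
          unfolding T_def sum_distrib_left sum_subtractf[symmetric]
          by (auto intro!: sum.cong simp: algebra_simps)
        show "q (\<lambda>j. u j - c * w j) \<le> 2 * q u + 2 * c\<^sup>2 * q w" for u w c
          using divide_right_mono[OF rayleigh_gap_diff_scale[OF n, of m x u c w], of g] g
          by (simp add: q_def add_divide_distrib)
        show "0 \<le> q u" for u using energy_le_top[OF n] g by (simp add: q_def)
        \<comment> \<open>A vector orthogonal to the first \<open>k\<close> rows has the same energy
          with or without them, hence at most \<open>top_energy m n x - g\<close> times its squared
          norm.\<close>
        show "sqnorm n u \<le> q u" if u: "\<And>i. i < k \<Longrightarrow> T i u = 0" for u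
        proof -
          have "(\<Sum>j=1..n. x (i, j) * u j) = 0" if "i \<in> {1..k}" for i
            using u[of "i - 1"] that by (auto simp: T_def)
          then have "energy k n x u = 0" by (simp add: energy_def)
          then have "energy m n x u \<le> top_energy m n (drop_rows k x) * sqnorm n u"
            using energy_drop_rows[OF k, of n x u] energy_le_top[OF n, of m "drop_rows k x" u] by linarith
          also have "\<dots> \<le> (top_energy m n x - g) * sqnorm n u"
            using gap sqnorm_nonneg by (intro mult_right_mono) auto
          finally show "sqnorm n u \<le> q u" using g by (simp add: q_def field_simps)
        qed
        show "L2_set w {1..n} \<le> 1 \<and> q w \<le> \<eta>" if "w \<in> S" for w
          using that S(2) W[of w] g half_sphere_iff[of w n] by (auto simp: q_def half_sphere_def field_simps)
      qed (use S in auto)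
    qed
  qed
qed

section \<open>Moments of sums of independent variables\<close>

lemma (in prob_space) integrable_lower_power:
  fixes f :: "'a \<Rightarrow> real"
  assumes f[measurable]: "f \<in> borel_measurable M" and int: "integrable M (\<lambda>x. f x ^ 4)" and "k \<le> 4"
  shows "integrable M (\<lambda>x. f x ^ k)"
proof (rule Bochner_Integration.integrable_bound)
  show "integrable M (\<lambda>x. 1 + f x ^ 4)" using int by simp
  have "\<bar>t\<bar> ^ k \<le> 1 + t ^ 4" for t :: real
  proof (cases "\<bar>t\<bar> \<le> 1")
    case True
    then have "\<bar>t\<bar> ^ k \<le> 1" by (simp add: power_le_one)
    then show ?thesis by (simp add: add_increasing2)
  next
    case False
    then have "\<bar>t\<bar> ^ k \<le> \<bar>t\<bar> ^ 4" using assms(3) by (intro power_increasing) auto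
    then show ?thesis by simp
  qed
  then show "AE x in M. norm (f x ^ k) \<le> norm (1 + f x ^ 4)"
    by (simp add: power_abs)
qed measurable

text \<open>Variances of independent centred variables add up. The induction splits off one summand,
  which is independent of the sum of the others, so the mixed term has expectation zero.\<close>

lemma (in prob_space) expectation_indep_sum_sq:
  fixes V :: real
  assumes "finite I" "indep_vars (\<lambda>_. borel) Z I"
    and "\<And>i. i \<in> I \<Longrightarrow> integrable M (\<lambda>\<omega>. (Z i \<omega>)\<^sup>2)"
    and "\<And>i. i \<in> I \<Longrightarrow> expectation (Z i) = 0"
    and "\<And>i. i \<in> I \<Longrightarrow> expectation (\<lambda>\<omega>. (Z i \<omega>)\<^sup>2) \<le> V"
  shows "integrable M (\<lambda>\<omega>. (\<Sum>i\<in>I. Z i \<omega> :: real)\<^sup>2)"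
    and "expectation (\<lambda>\<omega>. (\<Sum>i\<in>I. Z i \<omega>)\<^sup>2) \<le> card I * V"
proof -
  have "integrable M (\<lambda>\<omega>. (\<Sum>i\<in>I. Z i \<omega>)\<^sup>2) \<and> expectation (\<lambda>\<omega>. (\<Sum>i\<in>I. Z i \<omega>)\<^sup>2) \<le> card I * V"
    using assms
  proof (induction I rule: finite_induct)
    case (insert i I)
    define S where "S \<omega> = (\<Sum>i\<in>I. Z i \<omega>)" for \<omega>
    have meas[measurable]: "Z j \<in> borel_measurable M" if "j \<in> insert i I" for j
      using insert.prems(1) that by (auto simp: indep_vars_def)
    have Smeas[measurable]: "S \<in> borel_measurable M"
      unfolding S_def using meas by (intro borel_measurable_sum) auto
    have "indep_vars (\<lambda>_. borel) Z I"
      using insert.prems(1) by (rule indep_vars_subset) auto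
    then have IH: "integrable M (\<lambda>\<omega>. (S \<omega>)\<^sup>2)" "expectation (\<lambda>\<omega>. (S \<omega>)\<^sup>2) \<le> card I * V"
      using insert.IH insert.prems unfolding S_def by auto
    have Sint: "integrable M S"
      by (rule square_integrable_imp_integrable) (use Smeas IH in auto)
    have Zint: "integrable M (Z i)" "integrable M (\<lambda>\<omega>. (Z i \<omega>)\<^sup>2)"
      using insert.prems(2)[of i] meas by (auto intro: square_integrable_imp_integrable)
    have ind: "indep_var borel (Z i) borel S"
      unfolding S_def by (rule indep_vars_sum) (use insert in auto)
    have ZS: "integrable M (\<lambda>\<omega>. Z i \<omega> * S \<omega>)" "expectation (\<lambda>\<omega>. Z i \<omega> * S \<omega>) = 0"
      using indep_var_integrable[OF ind Zint(1) Sint] indep_var_lebesgue_integral[OF ind Zint(1) Sint]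
        insert.prems(3)[of i] by auto
    have eq: "(\<Sum>i\<in>insert i I. Z i \<omega>)\<^sup>2 = (Z i \<omega>)\<^sup>2 + 2 * (Z i \<omega> * S \<omega>) + (S \<omega>)\<^sup>2" for \<omega>
      using insert.hyps by (simp add: S_def power2_sum)
    have "expectation (\<lambda>\<omega>. (\<Sum>i\<in>insert i I. Z i \<omega>)\<^sup>2) \<le> V + card I * V"
      unfolding eq using ZS IH Zint insert.prems(4)[of i] by simp
    moreover have "integrable M (\<lambda>\<omega>. (\<Sum>i\<in>insert i I. Z i \<omega>)\<^sup>2)"
      unfolding eq using ZS IH Zint by simp
    ultimately show ?case using insert.hyps by (simp add: algebra_simps)
  qed simp
  then show "integrable M (\<lambda>\<omega>. (\<Sum>i\<in>I. Z i \<omega>)\<^sup>2)"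
    and "expectation (\<lambda>\<omega>. (\<Sum>i\<in>I. Z i \<omega>)\<^sup>2) \<le> card I * V" by auto
qed

text \<open>Chebyshev's inequality for the centred variables \<open>W i\<close>: falling below half
  the mean is a deviation of at least \<open>card I * a / 2\<close>, and the variance of each
  summand is at most its second moment.\<close>

lemma (in prob_space) indep_sum_lower_tail:
  fixes a V :: real
  assumes I: "finite I" "I \<noteq> {}" and ind: "indep_vars (\<lambda>_. borel) Z I"
    and int: "\<And>i. i \<in> I \<Longrightarrow> integrable M (\<lambda>\<omega>. (Z i \<omega>)\<^sup>2)"
    and mean: "\<And>i. i \<in> I \<Longrightarrow> expectation (Z i) = a"
    and sq: "\<And>i. i \<in> I \<Longrightarrow> expectation (\<lambda>\<omega>. (Z i \<omega>)\<^sup>2) \<le> V"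
    and a: "a > 0"
  shows "prob {\<omega> \<in> space M. (\<Sum>i\<in>I. Z i \<omega> :: real) \<le> card I * a / 2} \<le> 4 * V / (card I * a\<^sup>2)"
proof -
  define W where "W i \<omega> = Z i \<omega> - a" for i \<omega>
  have meas: "Z i \<in> borel_measurable M" if "i \<in> I" for i
    using ind that by (auto simp: indep_vars_def)
  have Zint: "integrable M (Z i)" if "i \<in> I" for i
    using int meas that by (auto intro: square_integrable_imp_integrable)
  have W: "indep_vars (\<lambda>_. borel) W I"
    unfolding W_def by (rule indep_vars_compose2[OF ind]) simp
  have eq: "(W i \<omega>)\<^sup>2 = (Z i \<omega>)\<^sup>2 - 2 * a * Z i \<omega> + a\<^sup>2" for i \<omega>
    by (simp add: W_def power2_diff)
  have Wint: "integrable M (\<lambda>\<omega>. (W i \<omega>)\<^sup>2)" if "i \<in> I" for i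
    unfolding eq using int Zint that by simp
  have Wsq: "expectation (\<lambda>\<omega>. (W i \<omega>)\<^sup>2) \<le> V" if "i \<in> I" for i
  proof -
    have "expectation (\<lambda>\<omega>. (W i \<omega>)\<^sup>2) = expectation (\<lambda>\<omega>. (Z i \<omega>)\<^sup>2) - a\<^sup>2"
      unfolding eq using int[OF that] Zint[OF that] mean[OF that]
      by (simp add: prob_space power2_eq_square)
    then show ?thesis
      using sq[OF that] zero_le_power2[of a] by linarith
  qed
  have W0: "expectation (W i) = 0" if "i \<in> I" for i
    unfolding W_def using Zint[OF that] mean[OF that] by (simp add: prob_space)
  note * = expectation_indep_sum_sq[OF I(1) W Wint W0 Wsq]
  define c where "c = (card I * a / 2)\<^sup>2"
  have c: "c > 0" using I a by (simp add: c_def card_gt_0_iff)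
  have "{\<omega> \<in> space M. (\<Sum>i\<in>I. Z i \<omega>) \<le> card I * a / 2} \<subseteq> {\<omega> \<in> space M. (\<Sum>i\<in>I. W i \<omega>)\<^sup>2 \<ge> c}"
  proof clarsimp
    fix \<omega> assume "(\<Sum>i\<in>I. Z i \<omega>) * 2 \<le> card I * a"
    then have "card I * a / 2 \<le> - (\<Sum>i\<in>I. W i \<omega>)" by (simp add: W_def sum_subtractf mult.commute)
    then have "c \<le> (- (\<Sum>i\<in>I. W i \<omega>))\<^sup>2"
      unfolding c_def using a by (intro power_mono) auto
    then show "c \<le> (\<Sum>i\<in>I. W i \<omega>)\<^sup>2" by simp
  qed
  then have "prob {\<omega> \<in> space M. (\<Sum>i\<in>I. Z i \<omega>) \<le> card I * a / 2} \<le> prob {\<omega> \<in> space M. (\<Sum>i\<in>I. W i \<omega>)\<^sup>2 \<ge> c}"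
    using *(1) by (intro finite_measure_mono) auto
  also have "\<dots> \<le> expectation (\<lambda>\<omega>. (\<Sum>i\<in>I. W i \<omega>)\<^sup>2) / c"
    using *(1) c by (intro integral_Markov_inequality_measure[where A = "{}"]) auto
  also have "\<dots> \<le> card I * V / c" using *(2) c by (simp add: divide_right_mono)
  also have "\<dots> = 4 * V / (card I * a\<^sup>2)"
    using I a by (simp add: c_def power2_eq_square divide_simps)
  finally show ?thesis .
qed

text \<open>In the expansion of the fourth power of a summand plus the remaining sum, the terms
  containing a first power vanish. What remains of the mixed terms is \<open>6 * b\<^sup>2\<close>
  times a product of weights; as \<open>3 * b\<^sup>2 \<le> C\<close>, it fits into the mixed term
  of \<open>C\<close> times the square of the total weight. The weights will be squares of
  coefficients.\<close>

lemma (in prob_space) indep_sum_fourth_moment: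
  fixes b C :: real and w :: "'i \<Rightarrow> real"
  assumes "finite I" "indep_vars (\<lambda>_. borel) Z I"
    and "\<And>i. i \<in> I \<Longrightarrow> integrable M (\<lambda>\<omega>. Z i \<omega> ^ 4)"
    and "\<And>i. i \<in> I \<Longrightarrow> expectation (Z i) = 0"
    and "\<And>i. i \<in> I \<Longrightarrow> expectation (\<lambda>\<omega>. (Z i \<omega>)\<^sup>2) = b * w i"
    and "\<And>i. i \<in> I \<Longrightarrow> expectation (\<lambda>\<omega>. Z i \<omega> ^ 4) \<le> C * (w i)\<^sup>2"
    and "\<And>i. i \<in> I \<Longrightarrow> 0 \<le> w i" and C: "3 * b\<^sup>2 \<le> C"
  shows "integrable M (\<lambda>\<omega>. (\<Sum>i\<in>I. Z i \<omega> :: real) ^ 4)"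
    and "expectation (\<lambda>\<omega>. (\<Sum>i\<in>I. Z i \<omega>)\<^sup>2) = b * (\<Sum>i\<in>I. w i)"
    and "expectation (\<lambda>\<omega>. (\<Sum>i\<in>I. Z i \<omega>) ^ 4) \<le> C * (\<Sum>i\<in>I. w i)\<^sup>2"
proof -
  have "integrable M (\<lambda>\<omega>. (\<Sum>i\<in>I. Z i \<omega>) ^ 4) \<and>
      expectation (\<lambda>\<omega>. \<Sum>i\<in>I. Z i \<omega>) = 0 \<and>
      expectation (\<lambda>\<omega>. (\<Sum>i\<in>I. Z i \<omega>)\<^sup>2) = b * (\<Sum>i\<in>I. w i) \<and>
      expectation (\<lambda>\<omega>. (\<Sum>i\<in>I. Z i \<omega>) ^ 4) \<le> C * (\<Sum>i\<in>I. w i)\<^sup>2"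
    using assms(1-7)
  proof (induction I rule: finite_induct)
    case (insert i I)
    define S where "S \<omega> = (\<Sum>i\<in>I. Z i \<omega>)" for \<omega>
    define s where "s = (\<Sum>i\<in>I. w i)"
    have s: "s \<ge> 0" "w i \<ge> 0" unfolding s_def using insert.prems by (auto intro: sum_nonneg)
    have meas[measurable]: "Z j \<in> borel_measurable M" if "j \<in> insert i I" for j
      using insert.prems(1) that by (auto simp: indep_vars_def)
    have Smeas[measurable]: "S \<in> borel_measurable M"
      unfolding S_def using meas by (intro borel_measurable_sum) auto
    have "indep_vars (\<lambda>_. borel) Z I"
      using insert.prems(1) by (rule indep_vars_subset) auto
    then have IH: "integrable M (\<lambda>\<omega>. S \<omega> ^ 4)" "expectation S = 0"
        "expectation (\<lambda>\<omega>. (S \<omega>)\<^sup>2) = b * s" "expectation (\<lambda>\<omega>. S \<omega> ^ 4) \<le> C * s\<^sup>2"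
      using insert.IH insert.prems unfolding S_def s_def by auto
    have Sint: "integrable M (\<lambda>\<omega>. S \<omega> ^ k)" if "k \<le> 4" for k
      by (rule integrable_lower_power) (use IH that in auto)
    have Zint: "integrable M (\<lambda>\<omega>. Z i \<omega> ^ k)" if "k \<le> 4" for k
      by (rule integrable_lower_power) (use insert.prems(2) that in auto)
    have ind: "indep_var borel (Z i) borel S"
      unfolding S_def by (rule indep_vars_sum) (use insert in auto)
    have indk: "indep_var borel (\<lambda>\<omega>. Z i \<omega> ^ k) borel (\<lambda>\<omega>. S \<omega> ^ l)" for k l
      using indep_var_compose[OF ind, of "\<lambda>x. x ^ k" borel "\<lambda>x. x ^ l" borel] by (simp add: comp_def)
    have ZS: "integrable M (\<lambda>\<omega>. Z i \<omega> ^ k * S \<omega> ^ l)"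
        "expectation (\<lambda>\<omega>. Z i \<omega> ^ k * S \<omega> ^ l) = expectation (\<lambda>\<omega>. Z i \<omega> ^ k) * expectation (\<lambda>\<omega>. S \<omega> ^ l)"
      if "k \<le> 4" "l \<le> 4" for k l
      using indep_var_integrable[OF indk Zint[OF that(1)] Sint[OF that(2)]]
        indep_var_lebesgue_integral[OF indk Zint[OF that(1)] Sint[OF that(2)]] by auto
    have sum_eq: "(\<Sum>i\<in>insert i I. Z i \<omega>) = Z i \<omega> + S \<omega>" for \<omega>
      using insert.hyps by (simp add: S_def)
    have w_eq: "(\<Sum>i\<in>insert i I. w i) = w i + s" using insert.hyps by (simp add: s_def)
    have eq4: "(Z i \<omega> + S \<omega>) ^ 4 = Z i \<omega> ^ 4 + 4 * (Z i \<omega> ^ 3 * S \<omega> ^ 1)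
        + 6 * (Z i \<omega> ^ 2 * S \<omega> ^ 2) + 4 * (Z i \<omega> ^ 1 * S \<omega> ^ 3) + S \<omega> ^ 4" for \<omega>
      by (simp add: power4_eq_xxxx power3_eq_cube power2_eq_square algebra_simps)
    have eq2: "(Z i \<omega> + S \<omega>)\<^sup>2 = Z i \<omega> ^ 2 + 2 * (Z i \<omega> ^ 1 * S \<omega> ^ 1) + S \<omega> ^ 2" for \<omega>
      by (simp add: power2_sum)
    have m: "expectation (\<lambda>\<omega>. Z i \<omega> ^ 1) = 0" "expectation (\<lambda>\<omega>. Z i \<omega> ^ 2) = b * w i"
        "expectation (\<lambda>\<omega>. Z i \<omega> ^ 4) \<le> C * (w i)\<^sup>2" "expectation (\<lambda>\<omega>. S \<omega> ^ 1) = 0"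
      using insert.prems(3-5)[of i] IH(2) by auto
    note ints = ZS(1)[of 3 1] ZS(1)[of 2 2] ZS(1)[of 1 3] ZS(1)[of 1 1] Zint[of 4] Sint[of 4] Zint[of 2] Sint[of 2]
    note prods = ZS(2)[of 3 1] ZS(2)[of 2 2] ZS(2)[of 1 3] ZS(2)[of 1 1]
    have e4: "expectation (\<lambda>\<omega>. (Z i \<omega> + S \<omega>) ^ 4) =
        expectation (\<lambda>\<omega>. Z i \<omega> ^ 4) + 6 * (b * w i * (b * s)) + expectation (\<lambda>\<omega>. S \<omega> ^ 4)"
      unfolding eq4 using ints prods m IH(3) by simp
    also have "\<dots> \<le> C * (w i)\<^sup>2 + 2 * (3 * b\<^sup>2) * (w i * s) + C * s\<^sup>2"
      using m(3) IH(4) by (simp add: power2_eq_square mult_ac)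
    also have "\<dots> \<le> C * (w i)\<^sup>2 + 2 * C * (w i * s) + C * s\<^sup>2"
      using C s by (intro add_mono mult_right_mono) auto
    also have "\<dots> = C * (w i + s)\<^sup>2" by (simp add: power2_sum algebra_simps)
    finally have "expectation (\<lambda>\<omega>. (Z i \<omega> + S \<omega>) ^ 4) \<le> C * (w i + s)\<^sup>2" .
    moreover have "integrable M (\<lambda>\<omega>. (Z i \<omega> + S \<omega>) ^ 4)" unfolding eq4 using ints by simp
    moreover have "expectation (\<lambda>\<omega>. (Z i \<omega> + S \<omega>)\<^sup>2) = b * (w i + s)"
      unfolding eq2 using ints prods m IH(3) by (simp add: distrib_left)
    moreover have "expectation (\<lambda>\<omega>. Z i \<omega> + S \<omega>) = 0"
      using m IH(2) Zint[of 1] Sint[of 1] by simp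
    ultimately show ?case unfolding sum_eq w_eq by simp
  qed simp
  then show "integrable M (\<lambda>\<omega>. (\<Sum>i\<in>I. Z i \<omega> :: real) ^ 4)"
    and "expectation (\<lambda>\<omega>. (\<Sum>i\<in>I. Z i \<omega>)\<^sup>2) = b * (\<Sum>i\<in>I. w i)"
    and "expectation (\<lambda>\<omega>. (\<Sum>i\<in>I. Z i \<omega>) ^ 4) \<le> C * (\<Sum>i\<in>I. w i)\<^sup>2" by auto
qed

section \<open>Independent entries with common moments\<close>

locale iid_entries = prob_space M for M :: "'a measure" +
  fixes X :: "'i \<Rightarrow> 'a \<Rightarrow> real" and I :: "'i set" and s2 \<kappa> :: real
  assumes finite_I: "finite I"
    and indep: "indep_vars (\<lambda>_. borel) X I"
    and int4: "l \<in> I \<Longrightarrow> integrable M (\<lambda>\<omega>. X l \<omega> ^ 4)"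
    and mean0: "l \<in> I \<Longrightarrow> expectation (X l) = 0"
    and second: "l \<in> I \<Longrightarrow> expectation (\<lambda>\<omega>. (X l \<omega>)\<^sup>2) = s2"
    and fourth: "l \<in> I \<Longrightarrow> expectation (\<lambda>\<omega>. X l \<omega> ^ 4) = \<kappa>"
begin

lemma measurable_entry: "l \<in> I \<Longrightarrow> X l \<in> borel_measurable M"
  using indep by (simp add: indep_vars_def)

lemma integrable_entry_power: "l \<in> I \<Longrightarrow> k \<le> 4 \<Longrightarrow> integrable M (\<lambda>\<omega>. X l \<omega> ^ k)"
  by (rule integrable_lower_power[OF measurable_entry int4])

lemma fourth_nonneg: "I \<noteq> {} \<Longrightarrow> 0 \<le> \<kappa>"
  using fourth by (metis all_not_in_conv Bochner_Integration.integral_nonneg zero_le_even_power even_numeral)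

lemma indep_blocks:
  assumes "\<And>j. j \<in> L \<Longrightarrow> K j \<subseteq> I" "disjoint_family_on K L"
    and "\<And>j. j \<in> L \<Longrightarrow> h j \<in> borel_measurable (PiM (K j) (\<lambda>_. borel))"
  shows "indep_vars (\<lambda>_. borel) (\<lambda>j \<omega>. h j (restrict (\<lambda>i. X i \<omega>) (K j)) :: real) L"
  by (rule indep_vars_compose2[OF indep_vars_restrict[OF indep assms(1,2)] assms(3)])

text \<open>With weights \<open>(v l)\<^sup>2\<close> of sum 1, the constant
  \<open>\<kappa> + 3 * s2\<^sup>2\<close> meets both conditions of
  \<open>indep_sum_fourth_moment\<close>; it does not depend on \<open>v\<close> or on the number of
  entries.\<close>

lemma linear_form_moments:
  assumes J: "J \<subseteq> I" and v: "(\<Sum>l\<in>J. (v l)\<^sup>2) = 1"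
  shows "integrable M (\<lambda>\<omega>. (\<Sum>l\<in>J. X l \<omega> * v l) ^ 4)"
    and "expectation (\<lambda>\<omega>. (\<Sum>l\<in>J. X l \<omega> * v l)\<^sup>2) = s2"
    and "expectation (\<lambda>\<omega>. (\<Sum>l\<in>J. X l \<omega> * v l) ^ 4) \<le> \<kappa> + 3 * s2\<^sup>2"
proof -
  define Z where "Z l \<omega> = X l \<omega> * v l" for l \<omega>
  have ind: "indep_vars (\<lambda>_. borel) Z J"
    unfolding Z_def by (rule indep_vars_compose2[OF indep_vars_subset[OF indep J]]) simp
  have "finite J" using J finite_I finite_subset by blast
  moreover have "integrable M (\<lambda>\<omega>. Z l \<omega> ^ 4)" if "l \<in> J" for l
    using int4[of l] J that by (auto simp: Z_def power_mult_distrib)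
  moreover have "expectation (Z l) = 0" if "l \<in> J" for l
    using mean0[of l] J that by (auto simp: Z_def[abs_def])
  moreover have "expectation (\<lambda>\<omega>. (Z l \<omega>)\<^sup>2) = s2 * (v l)\<^sup>2" if "l \<in> J" for l
    using second[of l] J that by (auto simp: Z_def power_mult_distrib)
  moreover have "expectation (\<lambda>\<omega>. Z l \<omega> ^ 4) \<le> (\<kappa> + 3 * s2\<^sup>2) * ((v l)\<^sup>2)\<^sup>2" if "l \<in> J" for l
    using fourth[of l] J that by (auto simp: Z_def power_mult_distrib mult_right_mono)
  moreover have "I \<noteq> {}" using J v by auto
  then have "3 * s2\<^sup>2 \<le> \<kappa> + 3 * s2\<^sup>2" using fourth_nonneg by simp
  ultimately show "integrable M (\<lambda>\<omega>. (\<Sum>l\<in>J. X l \<omega> * v l) ^ 4)"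
    and "expectation (\<lambda>\<omega>. (\<Sum>l\<in>J. X l \<omega> * v l)\<^sup>2) = s2"
    and "expectation (\<lambda>\<omega>. (\<Sum>l\<in>J. X l \<omega> * v l) ^ 4) \<le> \<kappa> + 3 * s2\<^sup>2"
    using indep_sum_fourth_moment[OF _ ind, of s2 "\<lambda>l. (v l)\<^sup>2" "\<kappa> + 3 * s2\<^sup>2"] v
    by (simp_all add: Z_def)
qed

end

lemma energy_eq_sum_entries:
  "energy k n x v = (\<Sum>i=1..k. (\<Sum>l\<in>{i} \<times> {1..n}. x l * v (snd l))\<^sup>2)"
proof -
  have "(\<Sum>l\<in>{i} \<times> {1..n}. x l * v (snd l)) = (\<Sum>j=1..n. x (i, j) * v j)" for i
    by (rule sum.reindex_bij_witness[where i = "\<lambda>j. (i, j)" and j = snd]) auto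
  then show ?thesis by (simp add: energy_def)
qed

text \<open>This will be instantiated both with the law of the whole matrix and with the law of the
  deleted rows alone.\<close>

locale iid_matrix = iid_entries M X I s2 \<kappa>
  for M :: "'a measure" and X :: "nat \<times> nat \<Rightarrow> 'a \<Rightarrow> real" and I s2 \<kappa>

text \<open>For a fixed unit vector the squared products with the rows are independent, each with
  mean \<open>s2\<close> and second moment at most \<open>\<kappa> + 3 * s2\<^sup>2\<close>, so the
  lower tail bound for sums applies to the \<open>k\<close> rows.\<close>

lemma (in iid_matrix) energy_lower_tail:
  assumes I: "{1..k} \<times> {1..n} \<subseteq> I" and k: "k \<ge> 1" and v: "sqnorm n v = 1" and s2: "s2 > 0"
  shows "prob {\<omega> \<in> space M. energy k n (\<lambda>l. X l \<omega>) v \<le> k * s2 / 2} \<le> 4 * (\<kappa> + 3 * s2\<^sup>2) / (k * s2\<^sup>2)"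
proof -
  define K where "K i = {i} \<times> {1..n}" for i :: nat
  define Z where "Z i \<omega> = (\<Sum>l\<in>K i. X l \<omega> * v (snd l))\<^sup>2" for i \<omega>
  have KI: "K i \<subseteq> I" if "i \<in> {1..k}" for i using I that by (auto simp: K_def)
  have "(\<Sum>l\<in>K i. (v (snd l))\<^sup>2) = sqnorm n v" for i
    unfolding K_def sqnorm_def
    by (rule sum.reindex_bij_witness[where i = "\<lambda>j. (i, j)" and j = snd]) auto
  then have vK: "(\<Sum>l\<in>K i. (v (snd l))\<^sup>2) = 1" for i using v by simp
  have "indep_vars (\<lambda>_. borel) (\<lambda>i \<omega>. (\<lambda>f. (\<Sum>l\<in>K i. f l * v (snd l))\<^sup>2) (restrict (\<lambda>l. X l \<omega>) (K i))) {1..k}"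
    by (rule indep_blocks[OF KI]) (auto simp: K_def disjoint_family_on_def)
  moreover have "(\<Sum>l\<in>K i. restrict (\<lambda>l. X l \<omega>) (K i) l * v (snd l)) = (\<Sum>l\<in>K i. X l \<omega> * v (snd l))" for i \<omega>
    by (intro sum.cong) auto
  ultimately have ind: "indep_vars (\<lambda>_. borel) Z {1..k}" by (simp add: Z_def[abs_def])
  have "prob {\<omega> \<in> space M. (\<Sum>i\<in>{1..k}. Z i \<omega>) \<le> card {1..k} * s2 / 2} \<le> 4 * (\<kappa> + 3 * s2\<^sup>2) / (card {1..k} * s2\<^sup>2)"
  proof (rule indep_sum_lower_tail[OF _ _ ind])
    fix i assume i: "i \<in> {1..k}"
    note mom = linear_form_moments[OF KI[OF i] vK]
    show "integrable M (\<lambda>\<omega>. (Z i \<omega>)\<^sup>2)" "expectation (Z i) = s2"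
      "expectation (\<lambda>\<omega>. (Z i \<omega>)\<^sup>2) \<le> \<kappa> + 3 * s2\<^sup>2"
      using mom by (simp_all add: Z_def[abs_def])
  qed (use k s2 in auto)
  then show ?thesis by (simp add: energy_eq_sum_entries Z_def K_def)
qed

text \<open>This will be applied to one full row, in the case where all rows are deleted.\<close>

lemma (in iid_entries) entry_square_sum_lower_tail:
  assumes J: "J \<subseteq> I" "J \<noteq> {}" and s2: "s2 > 0"
  shows "prob {\<omega> \<in> space M. (\<Sum>l\<in>J. (X l \<omega>)\<^sup>2) \<le> card J * s2 / 2} \<le> 4 * \<kappa> / (card J * s2\<^sup>2)"
proof (rule indep_sum_lower_tail)
  show "indep_vars (\<lambda>_. borel) (\<lambda>l \<omega>. (X l \<omega>)\<^sup>2) J"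
    by (rule indep_vars_compose2[OF indep_vars_subset[OF indep J(1)]]) simp
  fix l assume "l \<in> J"
  then show "integrable M (\<lambda>\<omega>. ((X l \<omega>)\<^sup>2)\<^sup>2)" "expectation (\<lambda>\<omega>. (X l \<omega>)\<^sup>2) = s2"
    "expectation (\<lambda>\<omega>. ((X l \<omega>)\<^sup>2)\<^sup>2) \<le> \<kappa>"
    using J int4[of l] second[of l] fourth[of l] by auto
qed (use J s2 finite_I finite_subset in auto)

text \<open>The sum is the trace of the square of x^T x. The \<open>n\<close> diagonal terms are of
  order m^2 each, while the off-diagonal ones are squares of centred independent sums and only of
  order m. Relative to \<open>(m n)^2\<close> this tends to 0 as \<open>m\<close> and
  \<open>n\<close> grow.\<close>

lemma (in iid_matrix) gram_square_expectation:
  assumes I: "I = {1..m} \<times> {1..n}" and m: "m \<ge> 1" and n: "n \<ge> 1"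
  shows "integrable M (\<lambda>\<omega>. \<Sum>j=1..n. \<Sum>j'=1..n. (\<Sum>i=1..m. X (i, j) \<omega> * X (i, j') \<omega>)\<^sup>2)"
    and "expectation (\<lambda>\<omega>. \<Sum>j=1..n. \<Sum>j'=1..n. (\<Sum>i=1..m. X (i, j) \<omega> * X (i, j') \<omega>)\<^sup>2)
      \<le> (real m * real n)\<^sup>2 * (s2\<^sup>2 / m + \<kappa> / n)"
proof -
  define G where "G j j' \<omega> = (\<Sum>i=1..m. X (i, j) \<omega> * X (i, j') \<omega>)\<^sup>2" for j j' \<omega>
  have ne: "I \<noteq> {}" using m n by (auto simp: I)
  have diag: "integrable M (G j j) \<and> expectation (G j j) \<le> m * (m * \<kappa>)" if j: "j \<in> {1..n}" for j
  proof -
    \<comment> \<open>Cauchy-Schwarz reduces the squared sum of \<open>m\<close> squares to fourth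
      powers.\<close>
    have le: "G j j \<omega> \<le> m * (\<Sum>i=1..m. X (i, j) \<omega> ^ 4)" for \<omega>
      using sum_squared_le_sum_of_squares[of "\<lambda>i. X (i, j) \<omega> * X (i, j) \<omega>" "{1..m}"]
      by (simp add: G_def power2_eq_square power4_eq_xxxx mult_ac)
    have int: "integrable M (\<lambda>\<omega>. m * (\<Sum>i=1..m. X (i, j) \<omega> ^ 4))"
      using int4 j by (auto simp: I)
    have [measurable]: "X (i, j) \<in> borel_measurable M" if "i \<in> {1..m}" for i
      using measurable_entry[of "(i, j)"] that j by (simp add: I)
    have intG: "integrable M (G j j)"
    proof (rule Bochner_Integration.integrable_bound[OF int])
      show "G j j \<in> borel_measurable M" unfolding G_def by measurable
      show "AE \<omega> in M. norm (G j j \<omega>) \<le> norm (m * (\<Sum>i=1..m. X (i, j) \<omega> ^ 4))"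
        using le by (auto simp: G_def intro: order_trans[OF _ abs_ge_self])
    qed
    moreover have "expectation (G j j) \<le> expectation (\<lambda>\<omega>. m * (\<Sum>i=1..m. X (i, j) \<omega> ^ 4))"
      using le by (intro integral_mono intG int) auto
    moreover have "expectation (\<lambda>\<omega>. m * (\<Sum>i=1..m. X (i, j) \<omega> ^ 4)) = m * (m * \<kappa>)"
      using int4 fourth j by (simp add: I)
    ultimately show ?thesis by linarith
  qed
  have offdiag: "integrable M (G j j') \<and> expectation (G j j') \<le> m * s2\<^sup>2"
    if j: "j \<in> {1..n}" "j' \<in> {1..n}" "j \<noteq> j'" for j j'
  proof -
    define Z where "Z i \<omega> = X (i, j) \<omega> * X (i, j') \<omega>" for i \<omega>
    define K where "K i = {(i, j), (i, j')}" for i :: nat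
    have "indep_vars (\<lambda>_. borel) (\<lambda>i \<omega>. (\<lambda>f. f (i, j) * f (i, j')) (restrict (\<lambda>l. X l \<omega>) (K i))) {1..m}"
    proof (rule indep_blocks)
      fix i
      have "(i, j) \<in> K i" "(i, j') \<in> K i" by (auto simp: K_def)
      then show "(\<lambda>f. f (i, j) * f (i, j')) \<in> borel_measurable (PiM (K i) (\<lambda>_. borel :: real measure))"
        by measurable
    qed (use j in \<open>auto simp: K_def I disjoint_family_on_def\<close>)
    then have ind: "indep_vars (\<lambda>_. borel) Z {1..m}" by (simp add: K_def Z_def[abs_def])
    have Z: "integrable M (\<lambda>\<omega>. (Z i \<omega>)\<^sup>2)" "expectation (Z i) = 0" "expectation (\<lambda>\<omega>. (Z i \<omega>)\<^sup>2) = s2\<^sup>2"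
      if i: "i \<in> {1..m}" for i
    proof -
      have l: "(i, j) \<in> I" "(i, j') \<in> I" using i j by (auto simp: I)
      have "indep_vars (\<lambda>_. borel) X (insert (i, j) {(i, j')})"
        by (rule indep_vars_subset[OF indep]) (use l in auto)
      from indep_vars_sum[OF _ _ this] have ind2: "indep_var borel (X (i, j)) borel (X (i, j'))"
        using j by simp
      have ind2k: "indep_var borel (\<lambda>\<omega>. X (i, j) \<omega> ^ 2) borel (\<lambda>\<omega>. X (i, j') \<omega> ^ 2)"
        using indep_var_compose[OF ind2, of "\<lambda>x. x ^ 2" borel "\<lambda>x. x ^ 2" borel] by (simp add: comp_def)
      have ints: "integrable M (X (i, j))" "integrable M (X (i, j'))"
          "integrable M (\<lambda>\<omega>. (X (i, j) \<omega>)\<^sup>2)" "integrable M (\<lambda>\<omega>. (X (i, j') \<omega>)\<^sup>2)"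
        using integrable_entry_power[of _ 1] integrable_entry_power[of _ 2] l by auto
      show "integrable M (\<lambda>\<omega>. (Z i \<omega>)\<^sup>2)" "expectation (Z i) = 0" "expectation (\<lambda>\<omega>. (Z i \<omega>)\<^sup>2) = s2\<^sup>2"
        using indep_var_lebesgue_integral[OF ind2 ints(1,2)] indep_var_integrable[OF ind2k ints(3,4)]
          indep_var_lebesgue_integral[OF ind2k ints(3,4)] mean0 second l
        by (simp_all add: Z_def[abs_def] power_mult_distrib power2_eq_square[of s2])
    qed
    show ?thesis
      using expectation_indep_sum_sq[OF _ ind, of "s2\<^sup>2"] Z by (auto simp: G_def[abs_def] Z_def)
  qed
  have int: "integrable M (G j j')" if "j \<in> {1..n}" "j' \<in> {1..n}" for j j'
    using diag offdiag that by (cases "j = j'") auto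
  show "integrable M (\<lambda>\<omega>. \<Sum>j=1..n. \<Sum>j'=1..n. (\<Sum>i=1..m. X (i, j) \<omega> * X (i, j') \<omega>)\<^sup>2)"
    using int unfolding G_def by (intro Bochner_Integration.integrable_sum) auto
  have "expectation (\<lambda>\<omega>. \<Sum>j=1..n. \<Sum>j'=1..n. G j j' \<omega>) = (\<Sum>j=1..n. \<Sum>j'=1..n. expectation (G j j'))"
    using int
    by (subst Bochner_Integration.integral_sum)
      (auto intro!: Bochner_Integration.integrable_sum sum.cong Bochner_Integration.integral_sum)
  \<comment> \<open>The off-diagonal bound is granted to the diagonal terms as well, which makes the
    double sum explicit.\<close>
  also have "\<dots> \<le> (\<Sum>j=1..n. \<Sum>j'=1..n. m * s2\<^sup>2 + (if j' = j then m * (m * \<kappa>) else 0))"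
  proof (intro sum_mono)
    fix j j' assume "j \<in> {1..n}" "j' \<in> {1..n}"
    then show "expectation (G j j') \<le> m * s2\<^sup>2 + (if j' = j then m * (m * \<kappa>) else 0)"
      using diag[of j] offdiag[of j j'] by (cases "j = j'") (auto simp: add_increasing)
  qed
  also have "\<dots> = real n * (real n * (m * s2\<^sup>2) + m * (m * \<kappa>))"
    by (simp add: sum.distrib)
  also have "\<dots> = (real m * real n)\<^sup>2 * (s2\<^sup>2 / m + \<kappa> / n)"
    using m n by (simp add: power2_eq_square field_simps)
  finally show "expectation (\<lambda>\<omega>. \<Sum>j=1..n. \<Sum>j'=1..n. (\<Sum>i=1..m. X (i, j) \<omega> * X (i, j') \<omega>)\<^sup>2)
      \<le> (real m * real n)\<^sup>2 * (s2\<^sup>2 / m + \<kappa> / n)"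
    by (simp add: G_def)
qed

section \<open>Exchanging an entry with its copy\<close>

abbreviation matrices :: "nat \<Rightarrow> nat \<Rightarrow> (nat \<times> nat \<Rightarrow> real) measure" where
  "matrices m n \<equiv> PiM ({1..m} \<times> {1..n}) (\<lambda>_. borel)"

text \<open>Equal entries give the same objective function and hence the same chosen minimizer. This
  allows passing to the restriction to the index set, outside of which \<open>drop_rows\<close> may
  alter a matrix.\<close>

lemma top_energy_cong:
  assumes "\<And>l. l \<in> {1..m} \<times> {1..n} \<Longrightarrow> x l = y l"
  shows "top_energy m n x = top_energy m n y"
proof -
  have e: "energy m n x = energy m n y"
    using assms by (auto simp: energy_def fun_eq_iff intro!: sum.cong)
  then have "objective m n x = objective m n y" by (auto simp: objective_eq_energy fun_eq_iff)
  then show ?thesis by (simp add: top_energy_def minimizer_def e)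
qed

lemma measurable_top_energy_comp:
  assumes "n \<ge> 1" "\<And>l. l \<in> {1..m} \<times> {1..n} \<Longrightarrow> (\<lambda>\<omega>. Y \<omega> l) \<in> borel_measurable M"
  shows "(\<lambda>\<omega>. top_energy m n (Y \<omega>)) \<in> borel_measurable M"
proof -
  have "(\<lambda>\<omega>. restrict (Y \<omega>) ({1..m} \<times> {1..n})) \<in> M \<rightarrow>\<^sub>M matrices m n"
    using assms(2) by (intro measurable_restrict) auto
  from measurable_compose[OF this top_energy_measurable[OF assms(1)]]
  have "(\<lambda>\<omega>. top_energy m n (restrict (Y \<omega>) ({1..m} \<times> {1..n}))) \<in> borel_measurable M" .
  also have "(\<lambda>\<omega>. top_energy m n (restrict (Y \<omega>) ({1..m} \<times> {1..n}))) = (\<lambda>\<omega>. top_energy m n (Y \<omega>))"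
    by (intro ext top_energy_cong) auto
  finally show ?thesis .
qed

section \<open>Measurable substitutes for subgradients\<close>

definition secant :: "nat \<Rightarrow> nat \<Rightarrow> nat \<times> nat \<Rightarrow> real \<Rightarrow> (nat \<times> nat \<Rightarrow> real) \<Rightarrow> real" where
  "secant m n l h x = (top_energy m n (x(l := x l + h)) - top_energy m n x) / h"

text \<open>
  The minimizer, hence \<open>slope\<close>, need not be measurable. \<open>slope_majorant\<close> is a measurable majorant,
  which equals \<open>slope\<close> in absolute value wherever \<open>top_energy\<close> is differentiable in the entry.
\<close>

definition slope_majorant :: "nat \<Rightarrow> nat \<Rightarrow> nat \<times> nat \<Rightarrow> (nat \<times> nat \<Rightarrow> real) \<Rightarrow> ennreal" where
  "slope_majorant m n l x =
     (INF k. ennreal (max (secant m n l (1 / Suc k) x) (- secant m n l (- (1 / Suc k)) x)))"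

text \<open>A difference quotient of a convex function lies between the subgradients at its two end
  points.\<close>

lemma secant_bounds:
  assumes "n \<ge> 1" "l \<in> {1..m} \<times> {1..n}" "h > 0"
  shows "slope m n x l \<le> secant m n l h x" "secant m n l (- h) x \<le> slope m n x l"
    and "secant m n l h x \<le> slope m n (x(l := x l + h)) l"
    and "slope m n (x(l := x l - h)) l \<le> secant m n l (- h) x"
proof -
  show "slope m n x l \<le> secant m n l h x" "secant m n l (- h) x \<le> slope m n x l"
    using top_energy_upd_ge[OF assms(1,2), of x "x l + h"] top_energy_upd_ge[OF assms(1,2), of x "x l - h"] assms(3)
    by (simp_all add: secant_def field_simps)
  show "secant m n l h x \<le> slope m n (x(l := x l + h)) l"
    using top_energy_upd_ge[OF assms(1,2), of "x(l := x l + h)" "x l"] assms(3)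
    by (simp add: secant_def field_simps)
  show "slope m n (x(l := x l - h)) l \<le> secant m n l (- h) x"
    using top_energy_upd_ge[OF assms(1,2), of "x(l := x l - h)" "x l"] assms(3)
    by (simp add: secant_def field_simps)
qed

lemma slope_le_majorant:
  assumes "n \<ge> 1" "l \<in> {1..m} \<times> {1..n}"
  shows "ennreal \<bar>slope m n x l\<bar> \<le> slope_majorant m n l x"
  unfolding slope_majorant_def
proof (rule INF_greatest, rule ennreal_leI)
  fix k
  have "(0::real) < 1 / Suc k" by simp
  from secant_bounds(1,2)[OF assms this, of x]
  show "\<bar>slope m n x l\<bar> \<le> max (secant m n l (1 / Suc k) x) (- secant m n l (- (1 / Suc k)) x)"
    by linarith
qed

lemma measurable_secant:
  assumes "n \<ge> 1" and l: "l \<in> {1..m} \<times> {1..n}"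
  shows "secant m n l h \<in> borel_measurable (matrices m n)"
proof -
  have "(\<lambda>x. top_energy m n (x(l := x l + h))) \<in> borel_measurable (matrices m n)"
  proof (rule measurable_top_energy_comp[OF assms(1)])
    fix l' assume l': "l' \<in> {1..m} \<times> {1..n}"
    show "(\<lambda>x. (x(l := x l + h)) l') \<in> borel_measurable (matrices m n)"
      using l l' by (cases "l' = l") (simp_all del: mem_Sigma_iff)
  qed
  then show ?thesis
    unfolding secant_def using top_energy_measurable[OF assms(1)] by measurable
qed

lemma measurable_slope_majorant:
  assumes "n \<ge> 1" "l \<in> {1..m} \<times> {1..n}"
  shows "slope_majorant m n l \<in> borel_measurable (matrices m n)"
  unfolding slope_majorant_def using measurable_secant[OF assms] by measurable

text \<open>The slope lies between the left and the right secant; if these come arbitrarily close,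
  both approximate it. The hypothesis uses only countably many secants, so that it describes a
  measurable set.\<close>

lemma slope_majorant_le:
  assumes "n \<ge> 1" "l \<in> {1..m} \<times> {1..n}"
    and diff: "\<And>N. \<exists>k. secant m n l (1 / Suc k) x - secant m n l (- (1 / Suc k)) x < 1 / Suc N"
  shows "slope_majorant m n l x \<le> ennreal \<bar>slope m n x l\<bar>"
proof (rule ennreal_le_epsilon)
  fix e :: real assume e: "e > 0"
  obtain N where "1 / Suc N < e" using nat_approx_posE[OF e] by blast
  then obtain k where k: "secant m n l (1 / Suc k) x - secant m n l (- (1 / Suc k)) x < e"
    using diff[of N] by (meson less_trans)
  have "(0::real) < 1 / Suc k" by simp
  from secant_bounds(1,2)[OF assms(1,2) this, of x] k
  have "max (secant m n l (1 / Suc k) x) (- secant m n l (- (1 / Suc k)) x) \<le> \<bar>slope m n x l\<bar> + e"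
    by linarith
  then have "ennreal (max (secant m n l (1 / Suc k) x) (- secant m n l (- (1 / Suc k)) x)) \<le> ennreal (\<bar>slope m n x l\<bar> + e)"
    by (rule ennreal_leI)
  also have "\<dots> = ennreal \<bar>slope m n x l\<bar> + ennreal e" using e by (simp add: ennreal_plus)
  finally show "slope_majorant m n l x \<le> ennreal \<bar>slope m n x l\<bar> + ennreal e"
    unfolding slope_majorant_def by (rule order_trans[OF INF_lower[OF UNIV_I]])
qed

text \<open>At a continuity point \<open>a\<close> the slopes at \<open>a + 1 / Suc k\<close> and
  \<open>a - 1 / Suc k\<close> have the same limit, and they enclose the two secants.\<close>

lemma ex_small_secant_diff:
  assumes "n \<ge> 1" "l \<in> {1..m} \<times> {1..n}" and cont: "isCont (\<lambda>t. slope m n (y(l := t)) l) a"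
  shows "\<exists>k. secant m n l (1 / Suc k) (y(l := a)) - secant m n l (- (1 / Suc k)) (y(l := a)) < 1 / Suc N"
proof -
  define s where "s t = slope m n (y(l := t)) l" for t
  have s: "isCont s a" using cont by (simp add: s_def[abs_def])
  have "(\<lambda>k. a + 1 / real (Suc k)) \<longlonglongrightarrow> a + 0" "(\<lambda>k. a - 1 / real (Suc k)) \<longlonglongrightarrow> a - 0"
    by (intro tendsto_intros LIMSEQ_Suc lim_1_over_n)+
  then have "(\<lambda>k. s (a + 1 / real (Suc k))) \<longlonglongrightarrow> s a" "(\<lambda>k. s (a - 1 / real (Suc k))) \<longlonglongrightarrow> s a"
    using s by (auto intro: isCont_tendsto_compose)
  then have "(\<lambda>k. s (a + 1 / real (Suc k)) - s (a - 1 / real (Suc k))) \<longlonglongrightarrow> s a - s a"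
    by (rule tendsto_diff)
  then have "\<forall>\<^sub>F k in sequentially. s (a + 1 / real (Suc k)) - s (a - 1 / real (Suc k)) < 1 / Suc N"
    by (rule order_tendstoD) simp
  then obtain k where k: "s (a + 1 / real (Suc k)) - s (a - 1 / real (Suc k)) < 1 / Suc N"
    using eventually_happens' sequentially_bot by blast
  have "(0::real) < 1 / Suc k" by simp
  from secant_bounds(3,4)[OF assms(1,2) this, where x = "y(l := a)"] k
  show ?thesis by (intro exI[of _ k]) (simp add: s_def)
qed

section \<open>Product measures of an atomless entry law\<close>

locale entry_law = prob_space P for P :: "real measure" +
  assumes sets_P: "sets P = sets borel"
    and no_atoms: "\<And>x. emeasure P {x} = 0"
    and int4: "integrable P (\<lambda>x. x ^ 4)"
    and mean_zero: "(\<integral>x. x \<partial>P) = 0"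
begin

definition "s2 = (\<integral>x. x\<^sup>2 \<partial>P)"

definition "\<kappa> = (\<integral>x. x ^ 4 \<partial>P)"

abbreviation "law m n \<equiv> PiM ({1..m::nat} \<times> {1..n::nat}) (\<lambda>_. P)"

lemma measurable_P: "measurable P N = measurable borel N"
  using sets_P by (rule measurable_cong_sets) simp

lemma sets_PiM_P: "sets (PiM J (\<lambda>_. P)) = sets (PiM J (\<lambda>_. borel))"
  using sets_P by (intro sets_PiM_cong) auto

lemma measurable_PiM_P: "measurable (PiM J (\<lambda>_. P)) N = measurable (PiM J (\<lambda>_. borel)) N"
  using sets_PiM_P by (rule measurable_cong_sets) simp

lemma measurable_law: "measurable (law m n) N = measurable (matrices m n) N"
  by (rule measurable_PiM_P)

lemma integrable_power: "k \<le> 4 \<Longrightarrow> integrable P (\<lambda>x. x ^ k)"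
  by (rule integrable_lower_power[OF _ int4]) (simp_all add: measurable_P)

text \<open>A law with zero second moment would be concentrated in 0, which would be an
  atom.\<close>

lemma s2_pos: "s2 > 0"
proof (rule ccontr)
  assume "\<not> s2 > 0"
  moreover have "s2 \<ge> 0" unfolding s2_def by (rule Bochner_Integration.integral_nonneg) simp
  ultimately have "s2 = 0" by simp
  then have "AE x in P. x\<^sup>2 = 0"
    using integral_nonneg_eq_0_iff_AE[OF integrable_power[of 2]] by (simp add: s2_def)
  then have "AE x in P. x \<in> {0}" by simp
  then have "prob {0} = 1" using sets_P by (subst prob_eq_1) auto
  then show False using no_atoms[of 0] by (simp add: measure_def)
qed

lemma countable_sets: "countable A \<Longrightarrow> A \<in> sets P"
  unfolding sets_P by (rule sets.countable) auto

lemma countable_null: "countable A \<Longrightarrow> emeasure P A = 0"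
proof -
  assume A: "countable A"
  have "A = (\<Union>x\<in>A. {x})" by auto
  moreover have "(\<Union>x\<in>A. {x}) \<in> null_sets P"
    by (rule null_sets_UN'[OF A]) (use no_atoms sets_P in \<open>auto simp: null_sets_def\<close>)
  ultimately show ?thesis by (simp add: null_sets_def)
qed

sublocale product_sigma_finite "\<lambda>_ :: nat \<times> nat. P"
  by unfold_locales

lemma prob_space_PiM_P: "prob_space (PiM J (\<lambda>_ :: nat \<times> nat. P))"
  by (rule prob_space_PiM) (rule prob_space_axioms)

lemma iid_matrix_PiM:
  assumes J: "finite J"
  shows "iid_matrix (PiM J (\<lambda>_. P)) (\<lambda>l x. x l) J s2 \<kappa>"
proof -
  interpret J: prob_space "PiM J (\<lambda>_ :: nat \<times> nat. P)" by (rule prob_space_PiM_P)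
  have comp: "distr (PiM J (\<lambda>_. P)) borel (\<lambda>x. x l) = P" if "l \<in> J" for l
    using distr_PiM_component[of J "\<lambda>_. P" l] prob_space_axioms that sets_P by (metis distr_cong)
  have meas: "(\<lambda>x. x l) \<in> borel_measurable (PiM J (\<lambda>_. P))" if "l \<in> J" for l
    using that unfolding measurable_PiM_P by measurable
  have integ: "integral\<^sup>L (PiM J (\<lambda>_. P)) (\<lambda>x. g (x l)) = integral\<^sup>L P g"
    "integrable P g \<Longrightarrow> integrable (PiM J (\<lambda>_. P)) (\<lambda>x. g (x l))"
    if "l \<in> J" "g \<in> borel_measurable borel" for l and g :: "real \<Rightarrow> real"
    using integral_distr[OF meas that(2)] integrable_distr_eq[OF meas that(2)] comp that(1) by auto
  have ind: "J.indep_vars (\<lambda>_. borel) (\<lambda>l x. x l) J"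
  proof (cases "J = {}")
    case True
    show ?thesis unfolding J.indep_vars_def J.indep_sets_def by (auto simp: True)
  next
    case False
    have "distr (PiM J (\<lambda>_. P)) (PiM J (\<lambda>_. borel)) (\<lambda>x. \<lambda>l\<in>J. x l) = distr (PiM J (\<lambda>_. P)) (PiM J (\<lambda>_. P)) (\<lambda>x. x)"
      by (rule distr_cong) (auto simp: sets_PiM_P space_PiM)
    also have "\<dots> = PiM J (\<lambda>_. P)" by simp
    also have "\<dots> = PiM J (\<lambda>l. distr (PiM J (\<lambda>_. P)) borel (\<lambda>x. x l))"
      by (rule PiM_cong) (auto simp: comp)
    finally show ?thesis
      using meas False by (subst J.indep_vars_iff_distr_eq_PiM') auto
  qed
  show ?thesis
  proof (unfold_locales, goal_cases)
    case (3 l)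
    then show ?case using integ(2)[of l "\<lambda>x. x ^ 4"] int4 by simp
  next
    case (4 l)
    then show ?case using integ(1)[of l "\<lambda>x. x"] mean_zero by simp
  next
    case (5 l)
    then show ?case using integ(1)[of l "\<lambda>x. x\<^sup>2"] by (simp add: s2_def)
  next
    case (6 l)
    then show ?case using integ(1)[of l "\<lambda>x. x ^ 4"] by (simp add: \<kappa>_def)
  qed (rule J ind)+
qed

text \<open>With all entries but \<open>l\<close> fixed, the slope is monotone in the entry
  \<open>l\<close> and so has countably many discontinuities, a null set for the atomless law
  \<open>P\<close>. Everywhere else the secants close up. Fubini's theorem makes the exceptional set
  null in the product.\<close>

lemma AE_slope_majorant:
  assumes n: "n \<ge> 1"
  shows "AE x in law m n. \<forall>l\<in>{1..m} \<times> {1..n}. slope_majorant m n l x = ennreal \<bar>slope m n x l\<bar>"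
proof -
  let ?I = "{1..m} \<times> {1..n}"
  define Q where "Q l x \<longleftrightarrow> (\<forall>N. \<exists>k. secant m n l (1 / Suc k) x - secant m n l (- (1 / Suc k)) x < 1 / Suc N)" for l x
  have "AE x in law m n. Q l x" if l: "l \<in> ?I" for l
  proof -
    define J where "J = ?I - {l}"
    have I: "?I = insert l J" and J: "finite J" "l \<notin> J" using l by (auto simp: J_def)
    define B where "B = {x \<in> space (law m n). \<not> Q l x}"
    note [measurable] = measurable_secant[OF n l]
    have "B = {x \<in> space (matrices m n). \<not> Q l x}"
      unfolding B_def sets_eq_imp_space_eq[OF sets_PiM_P] ..
    also have "\<dots> \<in> sets (matrices m n)" unfolding Q_def by measurable
    finally have B: "B \<in> sets (law m n)" by (simp only: sets_PiM_P)
    have "emeasure (law m n) B = (\<integral>\<^sup>+x. indicator B x \<partial>law m n)" using B by simp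
    also have "\<dots> = (\<integral>\<^sup>+y. \<integral>\<^sup>+a. indicator B (y(l := a)) \<partial>P \<partial>PiM J (\<lambda>_. P))"
      using B unfolding I by (intro product_nn_integral_insert[OF J]) auto
    also have "\<dots> = (\<integral>\<^sup>+y. 0 \<partial>PiM J (\<lambda>_. P))"
    proof (rule nn_integral_cong)
      fix y
      define N where "N = {a. \<not> isCont (\<lambda>t. slope m n (y(l := t)) l) a}"
      have N: "countable N"
        unfolding N_def by (rule mono_ctble_discont) (auto intro!: monoI slope_mono[OF n l])
      have "(\<integral>\<^sup>+a. indicator B (y(l := a)) \<partial>P) \<le> (\<integral>\<^sup>+a. indicator N a \<partial>P)"
        using ex_small_secant_diff[OF n l]
        by (intro nn_integral_mono) (auto simp: N_def B_def Q_def indicator_def)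
      also have "\<dots> = emeasure P N"
        by (rule nn_integral_indicator) (rule countable_sets[OF N])
      also have "\<dots> = 0" by (rule countable_null[OF N])
      finally show "(\<integral>\<^sup>+a. indicator B (y(l := a)) \<partial>P) = 0" by simp
    qed
    finally have "emeasure (law m n) B = 0" by simp
    then show ?thesis using B by (intro AE_I'[of B]) (auto simp: B_def null_sets_def)
  qed
  then have "AE x in law m n. \<forall>l\<in>?I. Q l x" by (intro AE_finite_allI) auto
  then show ?thesis
  proof eventually_elim
    case (elim x)
    then show ?case
      using slope_majorant_le[OF n] slope_le_majorant[OF n] by (auto intro!: antisym simp: Q_def)
  qed
qed

lemma measurable_law_upd:
  assumes l: "l \<in> {1..m} \<times> {1..n}"
  shows "(\<lambda>(y, b). y(l := b)) \<in> law m n \<Otimes>\<^sub>M P \<rightarrow>\<^sub>M law m n"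
  using measurable_add_dim[of l "{1..m} \<times> {1..n}" "\<lambda>_. P"] by (simp only: insert_absorb[OF l])

text \<open>The entry \<open>y l\<close> and the new value \<open>b\<close> are independent with the
  same law, so exchanging them preserves the joint law.\<close>

lemma swap_entry:
  assumes l: "l \<in> {1..m} \<times> {1..n}" and h: "case_prod h \<in> borel_measurable (law m n \<Otimes>\<^sub>M P)"
  shows "(\<integral>\<^sup>+y. \<integral>\<^sup>+b. h (y(l := b)) (y l) \<partial>P \<partial>law m n) = (\<integral>\<^sup>+y. \<integral>\<^sup>+b. h y b \<partial>P \<partial>law m n)"
proof -
  let ?I = "{1..m} \<times> {1..n}"
  define J where "J = ?I - {l}"
  have I: "?I = insert l J" and J: "finite J" "l \<notin> J" using l by (auto simp: J_def)
  interpret PP: pair_sigma_finite P P ..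
  have "(\<lambda>(y, b). (y(l := b), y l)) \<in> law m n \<Otimes>\<^sub>M P \<rightarrow>\<^sub>M law m n \<Otimes>\<^sub>M P"
    unfolding case_prod_beta'
    by (intro measurable_Pair measurable_law_upd[OF l, unfolded case_prod_beta'] measurable_compose[OF measurable_fst measurable_component_singleton[OF l]])
  from measurable_compose[OF this h] have "(\<lambda>(y, b). h (y(l := b)) (y l)) \<in> borel_measurable (law m n \<Otimes>\<^sub>M P)"
    by (simp add: case_prod_beta')
  then have m1: "(\<lambda>y. \<integral>\<^sup>+b. h (y(l := b)) (y l) \<partial>P) \<in> borel_measurable (law m n)"
    by (rule borel_measurable_nn_integral)
  have m2: "(\<lambda>y. \<integral>\<^sup>+b. h y b \<partial>P) \<in> borel_measurable (law m n)"
    using h by (rule borel_measurable_nn_integral)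
  have m3: "(\<lambda>(a, b). h (r(l := b)) a) \<in> borel_measurable (P \<Otimes>\<^sub>M P)" if r: "r \<in> space (PiM J (\<lambda>_. P))" for r
  proof -
    have "(\<lambda>b. r(l := b)) \<in> P \<rightarrow>\<^sub>M law m n"
      unfolding I using measurable_compose[OF measurable_Pair1'[OF r] measurable_add_dim] by simp
    then have "(\<lambda>(a, b). (r(l := b), a)) \<in> P \<Otimes>\<^sub>M P \<rightarrow>\<^sub>M law m n \<Otimes>\<^sub>M P"
      unfolding case_prod_beta'
      by (intro measurable_Pair measurable_fst measurable_compose[OF measurable_snd])
    from measurable_compose[OF this h] show ?thesis by (simp add: case_prod_beta')
  qed
  \<comment> \<open>The matrix \<open>y\<close> is split into its entry \<open>a\<close> at
    \<open>l\<close> and the remaining entries \<open>r\<close>; the update then overwrites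
    \<open>a\<close>, and Fubini's theorem for \<open>a\<close> and \<open>b\<close> performs the
    exchange.\<close>
  have "(\<integral>\<^sup>+y. \<integral>\<^sup>+b. h (y(l := b)) (y l) \<partial>P \<partial>law m n) =
      (\<integral>\<^sup>+r. \<integral>\<^sup>+a. \<integral>\<^sup>+b. h (r(l := b)) a \<partial>P \<partial>P \<partial>PiM J (\<lambda>_. P))"
    using m1 unfolding I by (subst product_nn_integral_insert[OF J]) auto
  also have "\<dots> = (\<integral>\<^sup>+r. \<integral>\<^sup>+b. \<integral>\<^sup>+a. h (r(l := b)) a \<partial>P \<partial>P \<partial>PiM J (\<lambda>_. P))"
    using m3 by (intro nn_integral_cong PP.Fubini'[symmetric])
  also have "\<dots> = (\<integral>\<^sup>+y. \<integral>\<^sup>+b. h y b \<partial>P \<partial>law m n)"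
    using m2 unfolding I by (subst product_nn_integral_insert[OF J]) auto
  finally show ?thesis .
qed

end

section \<open>Expected loss and eigenvalue gap\<close>

text \<open>The operator norm is at most the Frobenius norm, by Cauchy-Schwarz in every row.\<close>

lemma top_energy_le_entry_square_sum:
  assumes "n \<ge> 1"
  shows "top_energy m n x \<le> (\<Sum>l\<in>{1..m} \<times> {1..n}. (x l)\<^sup>2)"
proof -
  let ?v = "minimizer m n x"
  have "top_energy m n x \<le> (\<Sum>i=1..m. (\<Sum>j=1..n. (x (i, j))\<^sup>2) * sqnorm n ?v)"
    unfolding top_energy_def energy_def sqnorm_def
    by (intro sum_mono Cauchy_Schwarz_ineq_sum)
  then show ?thesis
    using sqnorm_minimizer[OF assms] by (simp add: sum.cartesian_product)
qed

text \<open>The top eigenvalue is the inner product of the Gram matrix with the rank-one matrix of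
  entries \<open>v j * v j'\<close>, which has Frobenius norm 1.\<close>

lemma top_energy_sq_le_gram:
  assumes "n \<ge> 1"
  shows "(top_energy m n x)\<^sup>2 \<le> (\<Sum>j=1..n. \<Sum>j'=1..n. (\<Sum>i=1..m. x (i, j) * x (i, j'))\<^sup>2)"
proof -
  let ?v = "minimizer m n x" and ?J = "{1..n} \<times> {1..n}"
  define G where "G p = (\<Sum>i=1..m. x (i, fst p) * x (i, snd p))" for p
  have "top_energy m n x = (\<Sum>i=1..m. \<Sum>p\<in>?J. x (i, fst p) * x (i, snd p) * (?v (fst p) * ?v (snd p)))"
    unfolding top_energy_def energy_def power2_eq_square sum_product sum.cartesian_product
    by (intro sum.cong) (auto simp: mult_ac)
  also have "\<dots> = (\<Sum>p\<in>?J. G p * (?v (fst p) * ?v (snd p)))"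
    by (subst sum.swap) (simp add: G_def sum_distrib_right)
  finally have "(top_energy m n x)\<^sup>2 \<le> (\<Sum>p\<in>?J. (G p)\<^sup>2) * (\<Sum>p\<in>?J. (?v (fst p) * ?v (snd p))\<^sup>2)"
    using Cauchy_Schwarz_ineq_sum by metis
  also have "(\<Sum>p\<in>?J. (?v (fst p) * ?v (snd p))\<^sup>2) = sqnorm n ?v * sqnorm n ?v"
    unfolding sqnorm_def sum_product sum.cartesian_product
    by (intro sum.cong) (auto simp: power_mult_distrib)
  finally show ?thesis
    using sqnorm_minimizer[OF assms] by (simp add: G_def sum.cartesian_product case_prod_beta)
qed

text \<open>The first row \<open>r\<close> itself is used as test vector: the first coordinate of
  \<open>x r\<close> is the squared norm of \<open>r\<close>.\<close>

lemma top_energy_ge_first_row: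
  assumes "n \<ge> 1" "m \<ge> 1"
  shows "(\<Sum>l\<in>{1} \<times> {1..n}. (x l)\<^sup>2) \<le> top_energy m n x"
proof -
  define r where "r = (\<lambda>j. x (1 :: nat, j))"
  have r: "(\<Sum>l\<in>{1} \<times> {1..n}. (x l)\<^sup>2) = sqnorm n r"
    unfolding sqnorm_def r_def
    by (rule sum.reindex_bij_witness[where i = "\<lambda>j. (1, j)" and j = snd]) auto
  have "(sqnorm n r)\<^sup>2 = (\<Sum>j=1..n. x (1, j) * r j)\<^sup>2" by (simp add: sqnorm_def r_def power2_eq_square)
  also have "\<dots> \<le> energy m n x r"
    unfolding energy_def using assms(2)
    by (intro member_le_sum[where f = "\<lambda>i. (\<Sum>j=1..n. x (i, j) * r j)\<^sup>2" and i = 1]) auto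
  also have "\<dots> \<le> top_energy m n x * sqnorm n r" by (rule energy_le_top[OF assms(1)])
  finally have "sqnorm n r * sqnorm n r \<le> top_energy m n x * sqnorm n r" by (simp add: power2_eq_square)
  then have "sqnorm n r \<le> top_energy m n x"
    using sqnorm_nonneg[of n r] top_energy_nonneg[of m n x] by (cases "sqnorm n r = 0") auto
  then show ?thesis by (simp only: r)
qed

context entry_law
begin

section \<open>Expectation of the top eigenvalue\<close>

lemma measurable_top_energy_law: "n \<ge> 1 \<Longrightarrow> top_energy m n \<in> borel_measurable (law m n)"
  unfolding measurable_law by (rule top_energy_measurable)

lemma integral_entry_square_sum:
  shows "integrable (law m n) (\<lambda>x. \<Sum>l\<in>{1..m} \<times> {1..n}. (x l)\<^sup>2)"
    and "(\<integral>x. (\<Sum>l\<in>{1..m} \<times> {1..n}. (x l)\<^sup>2) \<partial>law m n) = real m * real n * s2"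
proof -
  interpret A: iid_matrix "law m n" "\<lambda>l x. x l" "{1..m} \<times> {1..n}" s2 \<kappa>
    by (rule iid_matrix_PiM) simp
  have int: "integrable (law m n) (\<lambda>x. (x l)\<^sup>2)" if "l \<in> {1..m} \<times> {1..n}" for l
    using A.integrable_entry_power[OF that, of 2] by simp
  then show "integrable (law m n) (\<lambda>x. \<Sum>l\<in>{1..m} \<times> {1..n}. (x l)\<^sup>2)"
    by (rule Bochner_Integration.integrable_sum)
  show "(\<integral>x. (\<Sum>l\<in>{1..m} \<times> {1..n}. (x l)\<^sup>2) \<partial>law m n) = real m * real n * s2"
    using int A.second by (simp add: Bochner_Integration.integral_sum del: mem_Sigma_iff)
qed

lemma integrable_top_energy: "n \<ge> 1 \<Longrightarrow> integrable (law m n) (top_energy m n)"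
  by (rule Bochner_Integration.integrable_bound[OF integral_entry_square_sum(1) measurable_top_energy_law])
    (auto simp: top_energy_nonneg simp del: One_nat_def
      intro!: AE_I2 order_trans[OF top_energy_le_entry_square_sum abs_ge_self])

text \<open>A crude bound without any smallness; it serves the case of few rows.\<close>

lemma integral_top_energy_le:
  assumes "n \<ge> 1"
  shows "(\<integral>x. top_energy m n x \<partial>law m n) \<le> s2 * (real m * real n)"
proof -
  have "(\<integral>x. top_energy m n x \<partial>law m n) \<le> (\<integral>x. (\<Sum>l\<in>{1..m} \<times> {1..n}. (x l)\<^sup>2) \<partial>law m n)"
    by (intro integral_mono integrable_top_energy assms integral_entry_square_sum top_energy_le_entry_square_sum)
  then show ?thesis by (simp only: integral_entry_square_sum(2) mult_ac)
qed

text \<open>The constant \<open>c\<close> may be taken small once both dimensions are large, because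
  the Gram bound controls the second moment of the top eigenvalue.\<close>

lemma integral_top_energy_le':
  assumes n: "n \<ge> 1" and m: "m \<ge> 1" and c: "c > 0" "s2\<^sup>2 / m + \<kappa> / n \<le> c\<^sup>2"
  shows "(\<integral>x. top_energy m n x \<partial>law m n) \<le> c * (real m * real n)"
proof -
  interpret A: iid_matrix "law m n" "\<lambda>l x. x l" "{1..m} \<times> {1..n}" s2 \<kappa>
    by (rule iid_matrix_PiM) simp
  define T where "T x = (\<Sum>j=1..n. \<Sum>j'=1..n. (\<Sum>i=1..m. x (i, j) * x (i, j'))\<^sup>2)" for x :: "nat \<times> nat \<Rightarrow> real"
  define r where "r = c * (real m * real n)"
  have r: "r > 0" using c m n by (simp add: r_def)
  note gram = A.gram_square_expectation[OF refl m n]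
  have T: "integrable (law m n) T" using gram(1) by (simp add: T_def[abs_def])
  have "(\<integral>x. T x \<partial>law m n) \<le> (real m * real n)\<^sup>2 * (s2\<^sup>2 / m + \<kappa> / n)"
    using gram(2) by (simp add: T_def)
  also have "\<dots> \<le> (real m * real n)\<^sup>2 * c\<^sup>2" using c(2) by (intro mult_left_mono) auto
  finally have ET: "(\<integral>x. T x \<partial>law m n) \<le> r\<^sup>2" by (simp add: r_def power_mult_distrib mult_ac)
  \<comment> \<open>The inequality of arithmetic and geometric means takes the place of the
    Cauchy-Schwarz inequality for the expectation.\<close>
  have "top_energy m n x \<le> r / 2 + T x / (2 * r)" for x
  proof -
    have "2 * top_energy m n x * r \<le> (top_energy m n x)\<^sup>2 + r\<^sup>2" by (rule sum_squares_bound)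
    also have "\<dots> \<le> T x + r\<^sup>2" using top_energy_sq_le_gram[OF n] by (simp add: T_def)
    finally show ?thesis using r by (simp add: field_simps power2_eq_square)
  qed
  then have "(\<integral>x. top_energy m n x \<partial>law m n) \<le> (\<integral>x. r / 2 + T x / (2 * r) \<partial>law m n)"
    using T by (intro integral_mono integrable_top_energy n) (auto simp del: One_nat_def)
  also have "\<dots> = r / 2 + (\<integral>x. T x \<partial>law m n) / (2 * r)" using T by (simp add: A.prob_space del: One_nat_def)
  also have "\<dots> \<le> r / 2 + r\<^sup>2 / (2 * r)" using ET r by (intro add_mono divide_right_mono) auto
  also have "\<dots> = r" using r by (simp add: power2_eq_square)
  finally show ?thesis by (simp add: r_def)
qed

text \<open>The loss bound of \<open>near_optimal_minimizer_upd\<close> for replacing the entry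
  \<open>l\<close> of \<open>y\<close> by \<open>b\<close>, with slopes replaced by their measurable
  majorants.\<close>

definition cost :: "nat \<Rightarrow> nat \<Rightarrow> nat \<times> nat \<Rightarrow> (nat \<times> nat \<Rightarrow> real) \<Rightarrow> real \<Rightarrow> ennreal" where
  "cost m n l y b = ennreal \<bar>b - y l\<bar> * (slope_majorant m n l y + slope_majorant m n l (y(l := b)))"

lemma measurable_cost_parts:
  assumes n: "n \<ge> 1" and l: "l \<in> {1..m} \<times> {1..n}"
  shows "(\<lambda>(y, b). ennreal \<bar>b - y l\<bar> * slope_majorant m n l y) \<in> borel_measurable (law m n \<Otimes>\<^sub>M P)"
    and "(\<lambda>(y, b). ennreal \<bar>b - y l\<bar> * slope_majorant m n l (y(l := b))) \<in> borel_measurable (law m n \<Otimes>\<^sub>M P)"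
proof -
  have b: "(\<lambda>x. snd x) \<in> borel_measurable (law m n \<Otimes>\<^sub>M P)"
    using measurable_snd[of "law m n" P] by (simp add: measurable_cong_sets[OF refl sets_P])
  have y: "(\<lambda>x. fst x l) \<in> borel_measurable (law m n \<Otimes>\<^sub>M P)"
    using measurable_compose[OF measurable_fst measurable_component_singleton[OF l, of "\<lambda>_. P"]]
    by (simp add: measurable_cong_sets[OF refl sets_P])
  have S: "slope_majorant m n l \<in> borel_measurable (law m n)"
    unfolding measurable_law by (rule measurable_slope_majorant[OF n l])
  have d: "(\<lambda>x. ennreal \<bar>snd x - fst x l\<bar>) \<in> borel_measurable (law m n \<Otimes>\<^sub>M P)"
    using b y by measurable
  show "(\<lambda>(y, b). ennreal \<bar>b - y l\<bar> * slope_majorant m n l y) \<in> borel_measurable (law m n \<Otimes>\<^sub>M P)"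
    unfolding case_prod_beta' by (intro borel_measurable_times_ennreal d measurable_compose[OF measurable_fst S])
  show "(\<lambda>(y, b). ennreal \<bar>b - y l\<bar> * slope_majorant m n l (y(l := b))) \<in> borel_measurable (law m n \<Otimes>\<^sub>M P)"
    unfolding case_prod_beta'
    by (intro borel_measurable_times_ennreal d measurable_compose[OF measurable_law_upd[OF l, unfolded case_prod_beta'] S])
qed

lemma measurable_cost:
  assumes "n \<ge> 1" "l \<in> {1..m} \<times> {1..n}"
  shows "(\<lambda>(y, b). cost m n l y b) \<in> borel_measurable (law m n \<Otimes>\<^sub>M P)"
  using borel_measurable_add[OF measurable_cost_parts[OF assms]]
  by (simp add: cost_def distrib_left case_prod_beta')

text \<open>Exchanging \<open>y l\<close> and \<open>b\<close> leaves the size of the change as it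
  is and turns the slope at the new matrix into the slope at the old one, so both summands have the
  same integral.\<close>

lemma nn_integral_cost:
  assumes n: "n \<ge> 1" and l: "l \<in> {1..m} \<times> {1..n}"
  shows "(\<integral>\<^sup>+y. \<integral>\<^sup>+b. cost m n l y b \<partial>P \<partial>law m n) =
    2 * (\<integral>\<^sup>+y. \<integral>\<^sup>+b. ennreal \<bar>b - y l\<bar> * slope_majorant m n l y \<partial>P \<partial>law m n)"
proof -
  note parts = measurable_cost_parts[OF n l]
  define h where "h z c = ennreal \<bar>c - z l\<bar> * slope_majorant m n l z" for z c
  have h: "case_prod h \<in> borel_measurable (law m n \<Otimes>\<^sub>M P)" using parts(1) by (simp add: h_def[abs_def])
  have sec: "(\<lambda>b. g y b) \<in> borel_measurable P"
    if "case_prod g \<in> borel_measurable (law m n \<Otimes>\<^sub>M P)" "y \<in> space (law m n)"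
    for g :: "_ \<Rightarrow> _ \<Rightarrow> ennreal" and y
    using measurable_compose[OF measurable_Pair1'[OF that(2)] that(1)] by simp
  have "(\<integral>\<^sup>+y. \<integral>\<^sup>+b. cost m n l y b \<partial>P \<partial>law m n) =
      (\<integral>\<^sup>+y. (\<integral>\<^sup>+b. h y b \<partial>P) + (\<integral>\<^sup>+b. h (y(l := b)) (y l) \<partial>P) \<partial>law m n)"
  proof (rule nn_integral_cong)
    fix y assume y: "y \<in> space (law m n)"
    have "cost m n l y b = h y b + h (y(l := b)) (y l)" for b
      by (simp add: cost_def h_def distrib_left abs_minus_commute)
    then show "(\<integral>\<^sup>+b. cost m n l y b \<partial>P) = (\<integral>\<^sup>+b. h y b \<partial>P) + (\<integral>\<^sup>+b. h (y(l := b)) (y l) \<partial>P)"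
      using sec[OF parts(1) y] sec[OF parts(2) y]
      by (simp add: nn_integral_add h_def abs_minus_commute)
  qed
  also have "\<dots> = (\<integral>\<^sup>+y. \<integral>\<^sup>+b. h y b \<partial>P \<partial>law m n) + (\<integral>\<^sup>+y. \<integral>\<^sup>+b. h (y(l := b)) (y l) \<partial>P \<partial>law m n)"
    using borel_measurable_nn_integral[OF parts(1)] borel_measurable_nn_integral[OF parts(2)]
    by (intro nn_integral_add) (simp_all add: h_def abs_minus_commute)
  also have "\<dots> = 2 * (\<integral>\<^sup>+y. \<integral>\<^sup>+b. h y b \<partial>P \<partial>law m n)"
    unfolding swap_entry[OF l h] by (simp add: mult_2)
  finally show ?thesis by (simp add: h_def)
qed

lemma nn_integral_square_diff:
  assumes "\<tau> \<ge> 0" "d \<ge> 0"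
  shows "(\<integral>\<^sup>+b. ennreal (\<tau> * (b - a)\<^sup>2 + d) \<partial>P) = ennreal (\<tau> * (s2 + a\<^sup>2) + d)"
proof -
  have ints: "integrable P (\<lambda>x. x)" "integrable P (\<lambda>x. x\<^sup>2)"
    using integrable_power[of 1] integrable_power[of 2] by auto
  have eq: "\<tau> * (b - a)\<^sup>2 + d = \<tau> * b\<^sup>2 - 2 * \<tau> * a * b + (\<tau> * a\<^sup>2 + d)" for b
    by (simp add: power2_eq_square algebra_simps)
  have "integrable P (\<lambda>b. \<tau> * (b - a)\<^sup>2 + d)" unfolding eq using ints by simp
  moreover have "(\<integral>b. \<tau> * (b - a)\<^sup>2 + d \<partial>P) = \<tau> * (s2 + a\<^sup>2) + d"
    unfolding eq using ints mean_zero by (simp add: prob_space s2_def distrib_left)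
  ultimately show ?thesis using assms by (subst nn_integral_eq_integral) auto
qed

text \<open>Young's inequality with parameter \<open>\<tau>\<close> separates changes from slopes.
  The squared changes sum to \<open>2 * s2\<close> per entry in expectation, and the squared slopes
  sum to four times the top eigenvalue.\<close>

lemma sum_nn_integral_cost_le:
  assumes n: "n \<ge> 1" and \<tau>: "\<tau> > 0"
    and F: "(\<integral>x. top_energy m n x \<partial>law m n) \<le> c * (real m * real n)"
  shows "(\<Sum>l\<in>{1..m} \<times> {1..n}. \<integral>\<^sup>+y. \<integral>\<^sup>+b. cost m n l y b \<partial>P \<partial>law m n)
    \<le> ennreal (real m * real n * (2 * \<tau> * s2 + 4 * c / \<tau>))"
proof -
  let ?I = "{1..m} \<times> {1..n}"
  interpret A: iid_matrix "law m n" "\<lambda>l x. x l" ?I s2 \<kappa>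
    by (rule iid_matrix_PiM) simp
  \<comment> \<open>This bounds one half of the cost once the new values are integrated out:
    \<open>s2\<close> comes from the new entry, \<open>(y l)\<^sup>2\<close> from the old one, and
    the last term from \<open>sum_slope_sq\<close>.\<close>
  define B where "B y = \<tau> / 2 * (real m * real n * s2 + (\<Sum>l\<in>?I. (y l)\<^sup>2)) + 2 * top_energy m n y / \<tau>" for y
  have young: "\<bar>t\<bar> * \<bar>s\<bar> \<le> \<tau> / 2 * t\<^sup>2 + s\<^sup>2 / (2 * \<tau>)" for t s :: real
  proof -
    have "2 * (\<tau> * \<bar>t\<bar>) * \<bar>s\<bar> \<le> (\<tau> * \<bar>t\<bar>)\<^sup>2 + \<bar>s\<bar>\<^sup>2" by (rule sum_squares_bound)
    then show ?thesis using \<tau> by (simp add: field_simps power2_eq_square)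
  qed
  have "(\<Sum>l\<in>?I. \<integral>\<^sup>+y. \<integral>\<^sup>+b. cost m n l y b \<partial>P \<partial>law m n) =
      2 * (\<integral>\<^sup>+y. (\<Sum>l\<in>?I. \<integral>\<^sup>+b. ennreal \<bar>b - y l\<bar> * slope_majorant m n l y \<partial>P) \<partial>law m n)"
    using nn_integral_cost[OF n] borel_measurable_nn_integral[OF measurable_cost_parts(1)[OF n]]
    by (simp add: nn_integral_sum sum_distrib_left[symmetric] del: mem_Sigma_iff)
  also have "(\<integral>\<^sup>+y. (\<Sum>l\<in>?I. \<integral>\<^sup>+b. ennreal \<bar>b - y l\<bar> * slope_majorant m n l y \<partial>P) \<partial>law m n)
      \<le> (\<integral>\<^sup>+y. ennreal (B y) \<partial>law m n)"
  proof (rule nn_integral_mono_AE)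
    show "AE y in law m n. (\<Sum>l\<in>?I. \<integral>\<^sup>+b. ennreal \<bar>b - y l\<bar> * slope_majorant m n l y \<partial>P) \<le> ennreal (B y)"
      using AE_slope_majorant[OF n, of m]
    proof eventually_elim
      case (elim y)
      have "(\<Sum>l\<in>?I. \<integral>\<^sup>+b. ennreal \<bar>b - y l\<bar> * slope_majorant m n l y \<partial>P)
          \<le> (\<Sum>l\<in>?I. \<integral>\<^sup>+b. ennreal (\<tau> / 2 * (b - y l)\<^sup>2 + (slope m n y l)\<^sup>2 / (2 * \<tau>)) \<partial>P)"
      proof (intro sum_mono nn_integral_mono)
        fix l b assume "l \<in> ?I"
        then have "ennreal \<bar>b - y l\<bar> * slope_majorant m n l y = ennreal (\<bar>b - y l\<bar> * \<bar>slope m n y l\<bar>)"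
          using elim by (simp only: ennreal_mult[OF abs_ge_zero abs_ge_zero])
        also have "\<dots> \<le> ennreal (\<tau> / 2 * (b - y l)\<^sup>2 + (slope m n y l)\<^sup>2 / (2 * \<tau>))"
          by (intro ennreal_leI young)
        finally show "ennreal \<bar>b - y l\<bar> * slope_majorant m n l y
            \<le> ennreal (\<tau> / 2 * (b - y l)\<^sup>2 + (slope m n y l)\<^sup>2 / (2 * \<tau>))" .
      qed
      also have "\<dots> = (\<Sum>l\<in>?I. ennreal (\<tau> / 2 * (s2 + (y l)\<^sup>2) + (slope m n y l)\<^sup>2 / (2 * \<tau>)))"
        using \<tau> by (intro sum.cong nn_integral_square_diff) auto
      also have "\<dots> = ennreal (\<Sum>l\<in>?I. \<tau> / 2 * (s2 + (y l)\<^sup>2) + (slope m n y l)\<^sup>2 / (2 * \<tau>))"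
        using \<tau> s2_pos by (intro sum_ennreal) auto
      also have "(\<Sum>l\<in>?I. \<tau> / 2 * (s2 + (y l)\<^sup>2) + (slope m n y l)\<^sup>2 / (2 * \<tau>)) =
          \<tau> / 2 * (\<Sum>l\<in>?I. s2 + (y l)\<^sup>2) + (\<Sum>l\<in>?I. (slope m n y l)\<^sup>2) / (2 * \<tau>)"
        unfolding sum_distrib_left sum_divide_distrib sum.distrib[symmetric] ..
      also have "\<dots> = B y"
        unfolding sum_slope_sq[OF n] B_def by (simp add: sum.distrib)
      finally show ?case .
    qed
  qed
  also have "(\<integral>\<^sup>+y. ennreal (B y) \<partial>law m n) = ennreal (\<integral>y. B y \<partial>law m n)"
    unfolding B_def using integral_entry_square_sum(1) integrable_top_energy[OF n] \<tau> s2_pos top_energy_nonneg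
    by (intro nn_integral_eq_integral) (auto intro!: AE_I2 add_nonneg_nonneg mult_nonneg_nonneg sum_nonneg simp del: One_nat_def)
  also have "(\<integral>y. B y \<partial>law m n) = \<tau> / 2 * (2 * (real m * real n * s2)) + 2 * (\<integral>x. top_energy m n x \<partial>law m n) / \<tau>"
    unfolding B_def using integral_entry_square_sum[of m n] integrable_top_energy[OF n]
    by (simp add: A.prob_space del: One_nat_def)
  also have "2 * ennreal (\<tau> / 2 * (2 * (real m * real n * s2)) + 2 * (\<integral>x. top_energy m n x \<partial>law m n) / \<tau>)
      \<le> 2 * ennreal (\<tau> / 2 * (2 * (real m * real n * s2)) + 2 * (c * (real m * real n)) / \<tau>)"
    using F \<tau> by (intro mult_left_mono ennreal_leI add_mono divide_right_mono) auto
  also have "\<dots> = ennreal (2 * (\<tau> / 2 * (2 * (real m * real n * s2)) + 2 * (c * (real m * real n)) / \<tau>))"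
    by (simp only: ennreal_mult'[OF zero_le_numeral] ennreal_numeral)
  also have "2 * (\<tau> / 2 * (2 * (real m * real n * s2)) + 2 * (c * (real m * real n)) / \<tau>) =
      real m * real n * (2 * \<tau> * s2 + 4 * c / \<tau>)"
    using \<tau> by (simp add: field_simps)
  finally show ?thesis by (simp add: mult_left_mono)
qed

text \<open>Given the remaining rows \<open>R\<close>, the top eigenvector of the reduced matrix is
  a fixed vector, and the deleted rows \<open>J\<close> are independent of it. Its energy on them is
  a lower bound for the gap, to which \<open>energy_lower_tail\<close> applies in every section of
  the product.\<close>

lemma drop_rows_gap:
  assumes n: "n \<ge> 1" and k: "1 \<le> k" "k \<le> m"
  defines "A \<equiv> {x \<in> space (law m n). top_energy m n x < top_energy m n (drop_rows k x) + k * s2 / 2}"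
  shows "A \<in> sets (law m n)"
    and "emeasure (law m n) A \<le> ennreal (4 * (\<kappa> + 3 * s2\<^sup>2) / (k * s2\<^sup>2))"
proof -
  let ?I = "{1..m} \<times> {1..n}"
  define J where "J = {1..k} \<times> {1..n}"
  define R where "R = {Suc k..m} \<times> {1..n}"
  have IRJ: "?I = R \<union> J" "R \<inter> J = {}" "finite R" "finite J"
    using k by (auto simp: J_def R_def)
  have drop_meas: "(\<lambda>x. top_energy m n (drop_rows k x)) \<in> borel_measurable (law m n)"
    unfolding measurable_law
  proof (rule measurable_top_energy_comp[OF n])
    fix l assume l: "l \<in> ?I"
    then show "(\<lambda>x. drop_rows k x l) \<in> borel_measurable (matrices m n)"
      unfolding drop_rows_def by (cases "fst l \<le> k") (simp_all del: mem_Sigma_iff)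
  qed
  show A: "A \<in> sets (law m n)"
    unfolding A_def using drop_meas measurable_top_energy_law[OF n, of m] by measurable
  interpret Q: iid_matrix "PiM J (\<lambda>_. P)" "\<lambda>l x. x l" J s2 \<kappa>
    by (rule iid_matrix_PiM) (simp add: J_def)
  interpret PR: prob_space "PiM R (\<lambda>_ :: nat \<times> nat. P)" by (rule prob_space_PiM_P)
  have "emeasure (law m n) A =
      (\<integral>\<^sup>+r. emeasure (PiM J (\<lambda>_. P)) ((\<lambda>a. merge R J (r, a)) -` A \<inter> space (PiM J (\<lambda>_. P))) \<partial>PiM R (\<lambda>_. P))"
    using emeasure_fold_integral[OF IRJ(2-4)] A unfolding IRJ(1) by simp
  also have "\<dots> \<le> (\<integral>\<^sup>+r. ennreal (4 * (\<kappa> + 3 * s2\<^sup>2) / (k * s2\<^sup>2)) \<partial>PiM R (\<lambda>_. P))"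
  proof (rule nn_integral_mono)
    fix r
    \<comment> \<open>The second \<open>r\<close> is a placeholder: \<open>drop_rows\<close> erases
      whatever is put into the rows \<open>J\<close>.\<close>
    define d where "d = drop_rows k (merge R J (r, r))"
    define v where "v = minimizer m n d"
    have v: "sqnorm n v = 1" unfolding v_def by (rule sqnorm_minimizer[OF n])
    have drop: "drop_rows k (merge R J (r, a)) = d" for a
      unfolding d_def drop_rows_def by (auto simp: fun_eq_iff merge_def J_def)
    let ?S = "{a \<in> space (PiM J (\<lambda>_. P)). energy k n a v \<le> k * s2 / 2}"
    have "(\<lambda>a. merge R J (r, a)) -` A \<inter> space (PiM J (\<lambda>_. P)) \<subseteq> ?S"
    proof clarify
      fix a assume "merge R J (r, a) \<in> A"
      then have "top_energy m n (merge R J (r, a)) < energy m n d v + k * s2 / 2"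
        by (simp add: A_def drop top_energy_def v_def)
      moreover have "energy m n (merge R J (r, a)) v \<le> top_energy m n (merge R J (r, a))"
        using energy_le_top[OF n] v by (metis mult.right_neutral)
      moreover have "energy m n (merge R J (r, a)) v = energy m n d v + energy k n (merge R J (r, a)) v"
        using energy_drop_rows[OF k(2)] drop by metis
      moreover have "energy k n (merge R J (r, a)) v = energy k n a v"
        unfolding energy_def by (intro sum.cong) (auto simp: merge_def J_def R_def)
      ultimately show "energy k n a v \<le> k * s2 / 2" by linarith
    qed
    then have "emeasure (PiM J (\<lambda>_. P)) ((\<lambda>a. merge R J (r, a)) -` A \<inter> space (PiM J (\<lambda>_. P)))
        \<le> emeasure (PiM J (\<lambda>_. P)) ?S"
    proof (rule emeasure_mono)
      have "(\<lambda>a. energy k n a v) \<in> borel_measurable (PiM J (\<lambda>_. P))"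
        unfolding measurable_PiM_P J_def by (rule energy_measurable)
      then show "?S \<in> sets (PiM J (\<lambda>_. P))" by measurable
    qed
    also have "\<dots> = ennreal (Q.prob ?S)" by (rule Q.emeasure_eq_measure)
    also have "\<dots> \<le> ennreal (4 * (\<kappa> + 3 * s2\<^sup>2) / (k * s2\<^sup>2))"
      using Q.energy_lower_tail[of k n v] k v s2_pos by (intro ennreal_leI) (simp add: J_def)
    finally show "emeasure (PiM J (\<lambda>_. P)) ((\<lambda>a. merge R J (r, a)) -` A \<inter> space (PiM J (\<lambda>_. P)))
        \<le> ennreal (4 * (\<kappa> + 3 * s2\<^sup>2) / (k * s2\<^sup>2))" .
  qed
  also have "\<dots> = ennreal (4 * (\<kappa> + 3 * s2\<^sup>2) / (k * s2\<^sup>2))"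
    by (simp add: PR.emeasure_space_1)
  finally show "emeasure (law m n) A \<le> ennreal (4 * (\<kappa> + 3 * s2\<^sup>2) / (k * s2\<^sup>2))" .
qed

text \<open>After deleting all rows the eigenvalue is 0, so the gap is the top eigenvalue itself,
  which is at least the squared norm of the first row. For a bounded number of rows this gap still
  grows linearly in \<open>n\<close>.\<close>

lemma drop_all_rows_gap:
  assumes n: "n \<ge> 1" and m: "m \<ge> 1"
  defines "A \<equiv> {x \<in> space (law m n). top_energy m n x < top_energy m n (drop_rows m x) + n * s2 / 2}"
  shows "A \<in> sets (law m n)"
    and "emeasure (law m n) A \<le> ennreal (4 * \<kappa> / (n * s2\<^sup>2))"
proof -
  interpret Q: iid_matrix "law m n" "\<lambda>l x. x l" "{1..m} \<times> {1..n}" s2 \<kappa>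
    by (rule iid_matrix_PiM) simp
  have 0: "top_energy m n (drop_rows m x) = 0" for x
    by (simp add: top_energy_def energy_def drop_rows_def)
  show "A \<in> sets (law m n)"
    unfolding A_def 0 using measurable_top_energy_law[OF n, of m] by measurable
  have c: "card ({1 :: nat} \<times> {1..n}) = n" by (simp add: card_cartesian_product)
  let ?S = "{x \<in> space (law m n). (\<Sum>l\<in>{1} \<times> {1..n}. (x l)\<^sup>2) \<le> card ({1 :: nat} \<times> {1..n}) * s2 / 2}"
  have meas: "(\<lambda>x. \<Sum>l\<in>{1} \<times> {1..n}. (x l)\<^sup>2) \<in> borel_measurable (law m n)"
    unfolding measurable_law
    by (intro borel_measurable_sum borel_measurable_power measurable_component_singleton) (use m in auto)
  have "emeasure (law m n) A \<le> emeasure (law m n) ?S"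
    unfolding c
  proof (rule emeasure_mono)
    show "A \<subseteq> {x \<in> space (law m n). (\<Sum>l\<in>{1} \<times> {1..n}. (x l)\<^sup>2) \<le> n * s2 / 2}"
    proof
      fix x assume "x \<in> A"
      then show "x \<in> {x \<in> space (law m n). (\<Sum>l\<in>{1} \<times> {1..n}. (x l)\<^sup>2) \<le> n * s2 / 2}"
        using top_energy_ge_first_row[OF n m, of x] unfolding A_def 0 by simp
    qed
    show "{x \<in> space (law m n). (\<Sum>l\<in>{1} \<times> {1..n}. (x l)\<^sup>2) \<le> n * s2 / 2} \<in> sets (law m n)"
      using meas by measurable
  qed
  also have "\<dots> = ennreal (Q.prob ?S)" by (rule Q.emeasure_eq_measure)
  also have "\<dots> \<le> ennreal (4 * \<kappa> / (card ({1 :: nat} \<times> {1..n}) * s2\<^sup>2))"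
    by (intro ennreal_leI Q.entry_square_sum_lower_tail) (use m n s2_pos in auto)
  finally show "emeasure (law m n) A \<le> ennreal (4 * \<kappa> / (n * s2\<^sup>2))" unfolding c .
qed

end

section \<open>Stability\<close>

text \<open>The possibly nonmeasurable event is covered by two measurable ones: \<open>B1\<close>,
  where the gap fails, and \<open>B2\<close>, where the total cost is large. The first has
  probability at most \<open>p\<close>; the second summand of the bound is Markov's inequality for
  the total cost.\<close>

lemma (in entry_law) unstable_event_le:
  fixes \<Omega> :: "'w measure"
    and X' :: "nat \<times> nat \<Rightarrow> 'w \<Rightarrow> nat \<times> nat \<Rightarrow> real"
    and m n :: nat
  defines "I \<equiv> {1..m} \<times> {1..n}"
  assumes n: "n \<ge> 1" and m: "m \<ge> 1" and \<Omega>: "prob_space \<Omega>"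
    and X: "X \<in> \<Omega> \<rightarrow>\<^sub>M matrices m n" and X_law: "distr \<Omega> (matrices m n) X = law m n"
    and entry: "\<And>l. l \<in> I \<Longrightarrow> (\<lambda>\<omega>. X' l \<omega> l) \<in> borel_measurable \<Omega>"
    and pair_law: "\<And>l. l \<in> I \<Longrightarrow>
      distr \<Omega> (matrices m n \<Otimes>\<^sub>M borel) (\<lambda>\<omega>. (X \<omega>, X' l \<omega> l)) = law m n \<Otimes>\<^sub>M P"
    and \<epsilon>: "\<epsilon> > 0" and \<eta>: "\<eta> > 0" and g: "g > 0" and \<tau>: "\<tau> > 0"
    and packing: "\<And>x W. top_energy m n (drop_rows k x) + g \<le> top_energy m n x \<Longrightarrow>
      (\<And>w. w \<in> W \<Longrightarrow> w \<in> half_sphere n \<and> top_energy m n x - energy m n x w \<le> g * \<eta>) \<Longrightarrow>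
      packing_number W (euclid_dist n) \<epsilon> \<le> enat N"
    and gap_set: "{x \<in> space (law m n). top_energy m n x < top_energy m n (drop_rows k x) + g} \<in> sets (law m n)"
    and gap: "emeasure (law m n) {x \<in> space (law m n). top_energy m n x < top_energy m n (drop_rows k x) + g} \<le> ennreal p"
    and p: "p \<ge> 0" and c: "c \<ge> 0"
    and F: "(\<integral>x. top_energy m n x \<partial>law m n) \<le> c * (real m * real n)"
  shows "outer_measure_of \<Omega> {\<omega> \<in> space \<Omega>.
      (MIN A \<in> {A. A \<subseteq> I \<and> real (card A) > (1 - \<epsilon>) * real (card I)}.
         packing_number ((\<lambda>l. minimizer m n (override_on (X \<omega>) (X' l \<omega>) {l})) ` A) (euclid_dist n) \<epsilon>)
      \<ge> enat (Suc N)} \<le> ennreal (p + (2 * \<tau> * s2 + 4 * c / \<tau>) * (2 / (\<epsilon> * (g * \<eta>))))"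
proof -
  define Z where "Z l \<omega> = X' l \<omega> l" for l \<omega>
  have Z: "Z l \<in> borel_measurable \<Omega>" if "l \<in> I" for l
    using entry[OF that] by (simp add: Z_def[abs_def])

  interpret \<Omega>: prob_space \<Omega> by (rule \<Omega>)
  \<comment> \<open>\<open>S\<close> is the loss tolerated by the packing bound; \<open>T\<close> is
    the total cost reached when a share \<open>\<epsilon> / 2\<close> of all entries costs
    \<open>S\<close> each.\<close>
  define S where "S = g * \<eta>"
  define T where "T = real m * real n * (\<epsilon> / 2) * S"
  have S: "S > 0" using g \<eta> by (simp add: S_def)
  have T: "T > 0" using S \<epsilon> m n by (simp add: T_def)
  have card_I: "card I = m * n" and fin_I: "finite I" by (simp_all add: I_def card_cartesian_product)
  define A1 where "A1 = {x \<in> space (law m n). top_energy m n x < top_energy m n (drop_rows k x) + g}"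
  define B1 where "B1 = X -` A1 \<inter> space \<Omega>"
  define C where "C \<omega> = (\<Sum>l\<in>I. cost m n l (X \<omega>) (Z l \<omega>))" for \<omega>
  define B2 where "B2 = {\<omega> \<in> space \<Omega>. 1 \<le> ennreal (1 / T) * C \<omega>}"
  have pair_meas: "(\<lambda>\<omega>. (X \<omega>, Z l \<omega>)) \<in> \<Omega> \<rightarrow>\<^sub>M matrices m n \<Otimes>\<^sub>M borel" if "l \<in> I" for l
    using X Z[OF that] by (rule measurable_Pair)
  have sets_pair: "sets (law m n \<Otimes>\<^sub>M P) = sets (matrices m n \<Otimes>\<^sub>M borel)"
    by (rule sets_pair_measure_cong[OF sets_PiM_P sets_P])
  have cost_meas: "(\<lambda>z. cost m n l (fst z) (snd z)) \<in> borel_measurable (matrices m n \<Otimes>\<^sub>M borel)"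
    if "l \<in> I" for l
    using measurable_cost[OF n, of l m] that
    by (simp add: I_def case_prod_beta' measurable_cong_sets[OF sets_pair refl] del: One_nat_def)
  have C_meas: "C \<in> borel_measurable \<Omega>"
    unfolding C_def
    by (intro borel_measurable_sum) (use measurable_compose[OF pair_meas cost_meas] in auto)
  have B1: "B1 \<in> sets \<Omega>" "emeasure \<Omega> B1 \<le> ennreal p"
  proof -
    have A1: "A1 \<in> sets (matrices m n)" using gap_set by (simp only: A1_def sets_PiM_P)
    then show "B1 \<in> sets \<Omega>" unfolding B1_def by (rule measurable_sets[OF X])
    have "emeasure \<Omega> B1 = emeasure (distr \<Omega> (matrices m n) X) A1"
      unfolding B1_def by (rule emeasure_distr[OF X A1, symmetric])
    then show "emeasure \<Omega> B1 \<le> ennreal p" using gap by (simp only: X_law A1_def)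
  qed
  have B2: "B2 \<in> sets \<Omega>" unfolding B2_def using C_meas by measurable
  have "(\<integral>\<^sup>+\<omega>. C \<omega> \<partial>\<Omega>) = (\<Sum>l\<in>I. \<integral>\<^sup>+\<omega>. cost m n l (X \<omega>) (Z l \<omega>) \<partial>\<Omega>)"
    unfolding C_def
    by (intro nn_integral_sum) (use measurable_compose[OF pair_meas cost_meas] in auto)
  also have "\<dots> = (\<Sum>l\<in>I. \<integral>\<^sup>+y. \<integral>\<^sup>+b. cost m n l y b \<partial>P \<partial>law m n)"
  proof (rule sum.cong[OF refl])
    fix l assume l: "l \<in> I"
    have "(\<integral>\<^sup>+\<omega>. cost m n l (X \<omega>) (Z l \<omega>) \<partial>\<Omega>) =
        (\<integral>\<^sup>+z. cost m n l (fst z) (snd z) \<partial>distr \<Omega> (matrices m n \<Otimes>\<^sub>M borel) (\<lambda>\<omega>. (X \<omega>, Z l \<omega>)))"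
      using pair_meas[OF l] cost_meas[OF l] by (simp add: nn_integral_distr del: One_nat_def)
    also have "\<dots> = (\<integral>\<^sup>+z. (case z of (y, b) \<Rightarrow> cost m n l y b) \<partial>(law m n \<Otimes>\<^sub>M P))"
      unfolding Z_def pair_law[OF l] by (simp add: case_prod_beta')
    also have "\<dots> = (\<integral>\<^sup>+y. \<integral>\<^sup>+b. cost m n l y b \<partial>P \<partial>law m n)"
      using nn_integral_fst[OF measurable_cost[OF n, of l m]] l by (simp add: I_def del: One_nat_def)
    finally show "(\<integral>\<^sup>+\<omega>. cost m n l (X \<omega>) (Z l \<omega>) \<partial>\<Omega>) = (\<integral>\<^sup>+y. \<integral>\<^sup>+b. cost m n l y b \<partial>P \<partial>law m n)" .
  qed
  also have "\<dots> \<le> ennreal (real m * real n * (2 * \<tau> * s2 + 4 * c / \<tau>))"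
    unfolding I_def by (rule sum_nn_integral_cost_le[OF n \<tau> F])
  finally have EC: "(\<integral>\<^sup>+\<omega>. C \<omega> \<partial>\<Omega>) \<le> ennreal (real m * real n * (2 * \<tau> * s2 + 4 * c / \<tau>))" .
  have "emeasure \<Omega> B2 \<le> ennreal (1 / T) * (\<integral>\<^sup>+\<omega>. C \<omega> * indicator (space \<Omega>) \<omega> \<partial>\<Omega>)"
    unfolding B2_def by (rule nn_integral_Markov_inequality) (use C_meas in auto)
  also have "(\<integral>\<^sup>+\<omega>. C \<omega> * indicator (space \<Omega>) \<omega> \<partial>\<Omega>) = (\<integral>\<^sup>+\<omega>. C \<omega> \<partial>\<Omega>)"
    by (intro nn_integral_cong) auto
  also have "ennreal (1 / T) * (\<integral>\<^sup>+\<omega>. C \<omega> \<partial>\<Omega>)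
      \<le> ennreal (1 / T) * ennreal (real m * real n * (2 * \<tau> * s2 + 4 * c / \<tau>))"
    by (intro mult_left_mono EC) auto
  also have "\<dots> = ennreal ((2 * \<tau> * s2 + 4 * c / \<tau>) * (2 / (\<epsilon> * S)))"
  proof -
    have "1 / T * (real m * real n * q) = q * (2 / (\<epsilon> * S))" for q
      using m n S \<epsilon> by (simp add: T_def)
    moreover have "0 \<le> 1 / T" using T by simp
    ultimately show ?thesis by (simp only: ennreal_mult'[symmetric])
  qed
  finally have B2_le: "emeasure \<Omega> B2 \<le> ennreal ((2 * \<tau> * s2 + 4 * c / \<tau>) * (2 / (\<epsilon> * S)))" .
  let ?\<A> = "{A. A \<subseteq> I \<and> real (card A) > (1 - \<epsilon>) * real (card I)}"
  let ?U = "{\<omega> \<in> space \<Omega>.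
      (MIN A \<in> ?\<A>. packing_number ((\<lambda>l. minimizer m n (override_on (X \<omega>) (X' l \<omega>) {l})) ` A) (euclid_dist n) \<epsilon>)
      \<ge> enat (Suc N)}"
  \<comment> \<open>Off \<open>B1\<close> and \<open>B2\<close>, the set \<open>D\<close> of entries
    with cost above \<open>S\<close> has a share below \<open>\<epsilon> / 2\<close>. Its complement
    \<open>G\<close> is thus admissible in the minimum, and all solutions belonging to
    \<open>G\<close> are near-optimal for the one matrix \<open>x\<close>.\<close>
  have "?U \<subseteq> B1 \<union> B2"
  proof (rule ccontr)
    assume "\<not> ?U \<subseteq> B1 \<union> B2"
    then obtain \<omega> where \<omega>: "\<omega> \<in> ?U" "\<omega> \<notin> B1" "\<omega> \<notin> B2" by blast
    define x where "x = X \<omega>"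
    have sp: "\<omega> \<in> space \<Omega>" using \<omega>(1) by simp
    have "x \<in> space (law m n)"
      unfolding x_def sets_eq_imp_space_eq[OF sets_PiM_P] by (rule measurable_space[OF X sp])
    then have gapx: "top_energy m n (drop_rows k x) + g \<le> top_energy m n x"
      using \<omega>(2) sp by (auto simp: B1_def A1_def x_def)
    define G where "G = {l \<in> I. cost m n l x (Z l \<omega>) \<le> ennreal S}"
    define D where "D = I - G"
    have fin: "finite G" "finite D" using fin_I by (auto simp: G_def D_def)
    have "C \<omega> < ennreal T"
    proof (rule ccontr)
      assume "\<not> C \<omega> < ennreal T"
      then have "ennreal (1 / T) * ennreal T \<le> ennreal (1 / T) * C \<omega>"
        by (intro mult_left_mono) auto
      then show False using \<omega>(3) sp T by (simp add: B2_def ennreal_mult'[symmetric])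
    qed
    moreover have "ennreal (real (card D) * S) \<le> C \<omega>"
    proof -
      have "ennreal (real (card D) * S) = (\<Sum>l\<in>D. ennreal S)"
        using S by (simp add: ennreal_mult ennreal_of_nat_eq_real_of_nat)
      also have "\<dots> \<le> (\<Sum>l\<in>D. cost m n l x (Z l \<omega>))"
        by (intro sum_mono) (auto simp: D_def G_def)
      also have "\<dots> \<le> C \<omega>"
        unfolding C_def x_def by (intro sum_mono2 fin_I) (auto simp: D_def)
      finally show ?thesis .
    qed
    ultimately have "ennreal (real (card D) * S) < ennreal T" by (rule le_less_trans[rotated])
    then have "real (card D) * S < real m * real n * (\<epsilon> / 2) * S"
      unfolding T_def by (simp add: ennreal_less_iff S less_imp_le)
    then have "real (card D) < real m * real n * (\<epsilon> / 2)" using S by simp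
    moreover have "card I = card G + card D"
      using card_Diff_subset[of G I] card_mono[of I G] fin fin_I by (auto simp: D_def G_def)
    then have "real m * real n = real (card G) + real (card D)"
      unfolding card_I by (metis of_nat_add of_nat_mult)
    moreover have "0 < real m * real n * \<epsilon>" using m n \<epsilon> by simp
    ultimately have "(1 - \<epsilon>) * real (card I) < real (card G)"
      unfolding card_I of_nat_mult by (simp add: left_diff_distrib mult.commute)
    then have G: "G \<in> ?\<A>" by (auto simp: G_def)
    have pack: "packing_number ((\<lambda>l. minimizer m n (override_on (X \<omega>) (X' l \<omega>) {l})) ` G) (euclid_dist n) \<epsilon> \<le> enat N"
    proof (rule packing[OF gapx])
      fix w assume "w \<in> (\<lambda>l. minimizer m n (override_on (X \<omega>) (X' l \<omega>) {l})) ` G"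
      then obtain l where l: "l \<in> G" and w: "w = minimizer m n (override_on (X \<omega>) (X' l \<omega>) {l})" by blast
      have lI: "l \<in> {1..m} \<times> {1..n}" using l by (simp add: G_def I_def)
      have "override_on (X \<omega>) (X' l \<omega>) {l} = x(l := Z l \<omega>)"
        by (auto simp: override_on_def fun_eq_iff x_def Z_def)
      then have w: "w = minimizer m n (x(l := Z l \<omega>))" using w by simp
      let ?b = "Z l \<omega>"
      have "ennreal (\<bar>?b - x l\<bar> * (\<bar>slope m n x l\<bar> + \<bar>slope m n (x(l := ?b)) l\<bar>)) =
          ennreal \<bar>?b - x l\<bar> * (ennreal \<bar>slope m n x l\<bar> + ennreal \<bar>slope m n (x(l := ?b)) l\<bar>)"
        by (simp add: ennreal_mult ennreal_plus)
      also have "\<dots> \<le> cost m n l x ?b"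
        unfolding cost_def by (intro mult_left_mono add_mono slope_le_majorant n lI) auto
      also have "\<dots> \<le> ennreal S" using l by (simp add: G_def)
      finally have "\<bar>?b - x l\<bar> * (\<bar>slope m n x l\<bar> + \<bar>slope m n (x(l := ?b)) l\<bar>) \<le> S"
        using S by (simp add: ennreal_le_iff)
      then have "top_energy m n x - energy m n x w \<le> g * \<eta>"
        using near_optimal_minimizer_upd[OF n lI, of x ?b] by (simp add: w S_def)
      then show "w \<in> half_sphere n \<and> top_energy m n x - energy m n x w \<le> g * \<eta>"
        using minimizer_arg_min(1)[OF n] by (simp add: w)
    qed
    from \<omega>(1) have "enat (Suc N) \<le>
        (MIN A \<in> ?\<A>. packing_number ((\<lambda>l. minimizer m n (override_on (X \<omega>) (X' l \<omega>) {l})) ` A) (euclid_dist n) \<epsilon>)"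
      by blast
    also have "\<dots> \<le> packing_number ((\<lambda>l. minimizer m n (override_on (X \<omega>) (X' l \<omega>) {l})) ` G) (euclid_dist n) \<epsilon>"
    proof (rule Min_le)
      show "finite ((\<lambda>A. packing_number ((\<lambda>l. minimizer m n (override_on (X \<omega>) (X' l \<omega>) {l})) ` A) (euclid_dist n) \<epsilon>) ` ?\<A>)"
        using fin_I by (intro finite_imageI) (auto intro: finite_subset[of _ "Pow I"])
    qed (rule imageI[OF G])
    also note pack
    finally show False by simp
  qed
  then have "outer_measure_of \<Omega> ?U \<le> emeasure \<Omega> (B1 \<union> B2)"
    using outer_measure_of_mono[of ?U "B1 \<union> B2" \<Omega>] B1 B2 by simp
  also have "\<dots> \<le> emeasure \<Omega> B1 + emeasure \<Omega> B2" by (rule emeasure_subadditive) (use B1 B2 in auto)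
  also have "\<dots> \<le> ennreal p + ennreal ((2 * \<tau> * s2 + 4 * c / \<tau>) * (2 / (\<epsilon> * S)))"
    by (intro add_mono B1 B2_le)
  also have "\<dots> = ennreal (p + (2 * \<tau> * s2 + 4 * c / \<tau>) * (2 / (\<epsilon> * S)))"
    using p c \<tau> s2_pos \<epsilon> S by (intro ennreal_plus[symmetric]) (auto intro!: mult_nonneg_nonneg add_nonneg_nonneg)
  finally show ?thesis by (simp add: S_def)
qed

section \<open>Transfer from the given random variables to product measures\<close>

lemma (in entry_law) distr_iid:
  assumes "prob_space \<Omega>" "finite I" "I \<noteq> {}" and X: "X \<in> \<Omega> \<rightarrow>\<^sub>M PiM I (\<lambda>_. borel)"
    and ind: "prob_space.indep_vars \<Omega> (\<lambda>_. borel) (\<lambda>k \<omega>. X \<omega> k) I"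
    and law: "\<And>k. k \<in> I \<Longrightarrow> distr \<Omega> borel (\<lambda>\<omega>. X \<omega> k) = P"
  shows "distr \<Omega> (PiM I (\<lambda>_. borel)) X = PiM I (\<lambda>_. P)"
proof -
  interpret \<Omega>: prob_space \<Omega> by fact
  have "distr \<Omega> (PiM I (\<lambda>_. borel)) X = distr \<Omega> (PiM I (\<lambda>_. borel)) (\<lambda>\<omega>. \<lambda>k\<in>I. X \<omega> k)"
  proof (rule distr_cong)
    fix \<omega> assume "\<omega> \<in> space \<Omega>"
    from measurable_space[OF X this] show "X \<omega> = (\<lambda>k\<in>I. X \<omega> k)"
      by (simp add: space_PiM PiE_restrict)
  qed simp_all
  also have "\<dots> = PiM I (\<lambda>k. distr \<Omega> borel (\<lambda>\<omega>. X \<omega> k))"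
    using ind by (subst \<Omega>.indep_vars_iff_distr_eq_PiM'[symmetric])
      (auto simp: assms(3) intro: measurable_compose[OF X measurable_component_singleton])
  also have "\<dots> = PiM I (\<lambda>_. P)" by (intro PiM_cong) (simp_all add: law)
  finally show ?thesis .
qed

text \<open>Expected costs are added over the entries, so the random copies enter only through the
  joint law of the matrix and one new entry.\<close>

lemma (in entry_law) independent_copy_entry:
  fixes I :: "'i set"
  assumes "prob_space \<Omega>" and copy: "independent_copy \<Omega> (PiM I (\<lambda>_. borel)) X Y"
    and law: "distr \<Omega> (PiM I (\<lambda>_. borel)) X = PiM I (\<lambda>_. P)" and l: "l \<in> I"
  shows "(\<lambda>\<omega>. Y \<omega> l) \<in> borel_measurable \<Omega>"
    and "distr \<Omega> (PiM I (\<lambda>_. borel) \<Otimes>\<^sub>M borel) (\<lambda>\<omega>. (X \<omega>, Y \<omega> l)) = PiM I (\<lambda>_. P) \<Otimes>\<^sub>M P"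
proof -
  interpret \<Omega>: prob_space \<Omega> by fact
  let ?N = "PiM I (\<lambda>_. borel) :: ('i \<Rightarrow> real) measure"
  have ind: "\<Omega>.indep_var ?N X ?N Y" and Y_law: "distr \<Omega> ?N Y = PiM I (\<lambda>_. P)"
    using copy law by (auto simp: independent_copy_def)
  note Y = \<Omega>.indep_var_rv2[OF ind]
  have comp: "(\<lambda>x. x l) \<in> borel_measurable ?N" by (rule measurable_component_singleton[OF l])
  show "(\<lambda>\<omega>. Y \<omega> l) \<in> borel_measurable \<Omega>" by (rule measurable_compose[OF Y comp])
  have comp': "(\<lambda>x. x l) \<in> PiM I (\<lambda>_. P) \<rightarrow>\<^sub>M P"
    by (rule measurable_component_singleton[OF l])
  have comp_law: "distr (PiM I (\<lambda>_. P)) P (\<lambda>x. x l) = P"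
    by (rule distr_PiM_component[OF prob_space_axioms l])
  have "distr \<Omega> (?N \<Otimes>\<^sub>M borel) (\<lambda>\<omega>. (X \<omega>, Y \<omega> l)) =
      distr (distr \<Omega> (?N \<Otimes>\<^sub>M ?N) (\<lambda>\<omega>. (X \<omega>, Y \<omega>))) (?N \<Otimes>\<^sub>M borel) (\<lambda>(x, y). (x, y l))"
  proof (subst distr_distr)
    show "(\<lambda>(x, y). (x, y l)) \<in> ?N \<Otimes>\<^sub>M ?N \<rightarrow>\<^sub>M ?N \<Otimes>\<^sub>M borel"
      unfolding case_prod_beta'
      by (intro measurable_Pair measurable_fst measurable_compose[OF measurable_snd comp])
    show "(\<lambda>\<omega>. (X \<omega>, Y \<omega>)) \<in> \<Omega> \<rightarrow>\<^sub>M ?N \<Otimes>\<^sub>M ?N"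
      by (intro measurable_Pair \<Omega>.indep_var_rv1[OF ind] Y)
  qed (simp add: comp_def)
  also have "distr \<Omega> (?N \<Otimes>\<^sub>M ?N) (\<lambda>\<omega>. (X \<omega>, Y \<omega>)) = PiM I (\<lambda>_. P) \<Otimes>\<^sub>M PiM I (\<lambda>_. P)"
    using ind law Y_law by (simp add: \<Omega>.indep_var_distribution_eq)
  also have "distr \<dots> (?N \<Otimes>\<^sub>M borel) (\<lambda>(x, y). (x, y l)) =
      distr (PiM I (\<lambda>_. P) \<Otimes>\<^sub>M PiM I (\<lambda>_. P)) (PiM I (\<lambda>_. P) \<Otimes>\<^sub>M P) (\<lambda>(x, y). (x, y l))"
    by (rule distr_cong) (auto intro!: sets_pair_measure_cong simp: sets_PiM_P sets_P)
  also have "\<dots> = distr (PiM I (\<lambda>_. P)) (PiM I (\<lambda>_. P)) (\<lambda>x. x) \<Otimes>\<^sub>M distr (PiM I (\<lambda>_. P)) P (\<lambda>x. x l)"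
    by (rule pair_measure_distr[symmetric])
      (use comp' comp_law sigma_finite_measure_axioms in auto)
  also have "\<dots> = PiM I (\<lambda>_. P) \<Otimes>\<^sub>M P" by (simp add: comp_law)
  finally show "distr \<Omega> (?N \<Otimes>\<^sub>M borel) (\<lambda>\<omega>. (X \<omega>, Y \<omega> l)) = PiM I (\<lambda>_. P) \<Otimes>\<^sub>M P" .
qed

lemma entry_lawI:
  assumes "prob_space P" and dens: "P = density lborel (\<lambda>x. ennreal (f x))"
    and f: "f \<in> borel_measurable borel"
    and "integrable P (\<lambda>x. x ^ 4)" "(\<integral>x. x \<partial>P) = 0"
  shows "entry_law P"
proof -
  interpret prob_space P by fact
  have "emeasure P {x} = 0" for x
  proof -
    have "emeasure P {x} = (\<integral>\<^sup>+t. ennreal (f t) * indicator {x} t \<partial>lborel)"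
      unfolding dens using f by (subst emeasure_density) auto
    also have "\<dots> = 0" by (rule nn_integral_null_set) (simp add: null_sets_def)
    finally show ?thesis .
  qed
  moreover have "sets P = sets borel" by (simp add: dens)
  ultimately show ?thesis using assms(4,5) by unfold_locales auto
qed

text \<open>
  If \<open>m\<close> is large, few rows are dropped; the finitely many small values of \<open>m\<close>, for which the
  effect of a perturbation need not be small, are handled by dropping all rows.
\<close>

theorem theorem3p7p7:
  fixes m :: "nat \<Rightarrow> nat"
    and \<P> :: "real measure" and f :: "real \<Rightarrow> real"
    and \<Omega> :: "nat \<Rightarrow> 'w measure"
    and I :: "nat \<Rightarrow> (nat \<times> nat) set"
    and X :: "nat \<Rightarrow> 'w \<Rightarrow> nat \<times> nat \<Rightarrow> real"
    and X' :: "nat \<Rightarrow> nat \<times> nat \<Rightarrow> 'w \<Rightarrow> nat \<times> nat \<Rightarrow> real"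
  assumes m_pos: "\<And>n. n \<ge> 1 \<Longrightarrow> m n \<ge> 1"
    and I_eq: "\<And>n. I n = {1..m n} \<times> {1..n}"
    and f_meas: "f \<in> borel_measurable borel"
    and f_nonneg: "\<And>x. f x \<ge> 0"
    and density: "\<P> = density lborel (\<lambda>x. ennreal (f x))"
    and fourth_moment: "integrable \<P> (\<lambda>x. x ^ 4)"
    and mean_zero: "(\<integral>x. x \<partial>\<P>) = 0"
    and prob: "\<And>n. n \<ge> 1 \<Longrightarrow> prob_space (\<Omega> n)"
    and X_meas: "\<And>n. n \<ge> 1 \<Longrightarrow> X n \<in> \<Omega> n \<rightarrow>\<^sub>M (\<Pi>\<^sub>M k\<in>I n. borel)"
    and X_indep: "\<And>n. n \<ge> 1 \<Longrightarrow>
      prob_space.indep_vars (\<Omega> n) (\<lambda>_. borel) (\<lambda>k \<omega>. X n \<omega> k) (I n)"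
    and X_distr: "\<And>n k. n \<ge> 1 \<Longrightarrow> k \<in> I n \<Longrightarrow> distr (\<Omega> n) borel (\<lambda>\<omega>. X n \<omega> k) = \<P>"
    and X'_copy: "\<And>n l. n \<ge> 1 \<Longrightarrow> l \<in> I n \<Longrightarrow>
      independent_copy (\<Omega> n) (\<Pi>\<^sub>M k\<in>I n. borel) (X n) (X' n l)"
  shows "stable_under_small_perturbations \<Omega> I I (\<lambda>n l. {l}) X X'
           (\<lambda>n. minimizer (m n) n) euclid_dist"
proof -
  interpret \<Omega>1: prob_space "\<Omega> 1" by (rule prob) simp
  \<comment> \<open>That \<P> has total mass 1 is read off from the entry \<open>(1, 1)\<close> of
    the first matrix.\<close>
  have one: "(1, 1) \<in> I 1" using m_pos[of 1] by (simp add: I_eq)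
  have "prob_space \<P>"
    unfolding X_distr[OF order_refl one, symmetric]
    by (rule \<Omega>1.prob_space_distr) (rule measurable_compose[OF X_meas[OF order_refl] measurable_component_singleton[OF one]])
  then interpret entry_law \<P>
    using density f_meas fourth_moment mean_zero by (rule entry_lawI)
  \<comment> \<open>The threshold is \<open>Suc N\<close>, so that a packing number of at most
    \<open>N\<close> excludes the event.\<close>
  define U where "U \<epsilon> n N = outer_measure_of (\<Omega> n) {\<omega> \<in> space (\<Omega> n).
      (MIN A \<in> {A. A \<subseteq> I n \<and> real (card A) > (1 - \<epsilon>) * real (card (I n))}.
         packing_number ((\<lambda>l. minimizer (m n) n (override_on (X n \<omega>) (X' n l \<omega>) {l})) ` A) (euclid_dist n) \<epsilon>)
      \<ge> enat (Suc N)}" for \<epsilon> n N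
  have law_X: "distr (\<Omega> n) (PiM (I n) (\<lambda>_. borel)) (X n) = PiM (I n) (\<lambda>_. \<P>)" if "n \<ge> 1" for n
  proof (rule distr_iid[OF prob[OF that] _ _ X_meas[OF that] X_indep[OF that] X_distr[OF that]])
    show "finite (I n)" "I n \<noteq> {}" using that m_pos[OF that] by (auto simp: I_eq)
  qed
  have U_le: "U \<epsilon> n N \<le> ennreal (p + (2 * \<tau> * s2 + 4 * c / \<tau>) * (2 / (\<epsilon> * (g * \<eta>))))"
    if n: "n \<ge> 1" and pos: "\<epsilon> > 0" "\<eta> > 0" "g > 0" "\<tau> > 0" "p \<ge> 0" "c \<ge> 0"
      and packing: "\<And>x W. top_energy (m n) n (drop_rows k x) + g \<le> top_energy (m n) n x \<Longrightarrow>
        (\<And>w. w \<in> W \<Longrightarrow> w \<in> half_sphere n \<and> top_energy (m n) n x - energy (m n) n x w \<le> g * \<eta>) \<Longrightarrow>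
        packing_number W (euclid_dist n) \<epsilon> \<le> enat N"
      and gap: "{x \<in> space (law (m n) n). top_energy (m n) n x < top_energy (m n) n (drop_rows k x) + g} \<in> sets (law (m n) n)"
        "emeasure (law (m n) n) {x \<in> space (law (m n) n). top_energy (m n) n x < top_energy (m n) n (drop_rows k x) + g} \<le> ennreal p"
      and F: "(\<integral>x. top_energy (m n) n x \<partial>law (m n) n) \<le> c * (real (m n) * real n)"
    for \<epsilon> \<eta> g \<tau> p c :: real and n N k
    using unstable_event_le[OF n m_pos[OF n] prob[OF n] X_meas[OF n, unfolded I_eq] law_X[OF n, unfolded I_eq]
        independent_copy_entry[OF prob[OF n] X'_copy[OF n] law_X[OF n], unfolded I_eq] pos(1-4) packing gap pos(5,6) F]
    unfolding U_def I_eq by simp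
  have "\<exists>M. limsup (\<lambda>n. U \<epsilon> n M) \<le> ennreal \<delta>" if \<epsilon>: "\<epsilon> > 0" and \<delta>: "\<delta> > 0" for \<epsilon> \<delta> :: real
  proof -
    \<comment> \<open>The packing property is bundled into one predicate so that \<open>N\<close>
      and \<open>\<eta>\<close> can be chosen as functions of the number \<open>k\<close> of deleted
      rows.\<close>
    define B where "B k N \<eta> \<longleftrightarrow> \<eta> > 0 \<and> (\<forall>m n x g W. n \<ge> 1 \<longrightarrow> k \<le> m \<longrightarrow> g > 0 \<longrightarrow>
      top_energy m n (drop_rows k x) + g \<le> top_energy m n x \<longrightarrow>
      (\<forall>w\<in>W. w \<in> half_sphere n \<and> top_energy m n x - energy m n x w \<le> g * \<eta>) \<longrightarrow>
      packing_number W (euclid_dist n) \<epsilon> \<le> enat N)" for k N \<eta>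
    have "\<exists>N \<eta>. B k N \<eta>" for k
    proof (rule near_optimal_packing_bound[OF \<epsilon>, of k])
      fix N \<eta>
      assume \<eta>: "\<eta> > 0" and *: "\<And>m n x g W. n \<ge> 1 \<Longrightarrow> k \<le> m \<Longrightarrow> g > 0 \<Longrightarrow>
        top_energy m n (drop_rows k x) + g \<le> top_energy m n x \<Longrightarrow>
        (\<And>w. w \<in> W \<Longrightarrow> w \<in> half_sphere n \<and> top_energy m n x - energy m n x w \<le> g * \<eta>) \<Longrightarrow>
        packing_number W (euclid_dist n) \<epsilon> \<le> enat N"
      have "B k N \<eta>"
        unfolding B_def
      proof (intro conjI allI impI)
        fix m n x g W
        assume **: "n \<ge> 1" "k \<le> m" "g > 0" "top_energy m n (drop_rows k x) + g \<le> top_energy m n x"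
          and W: "\<forall>w\<in>W. w \<in> half_sphere n \<and> top_energy m n x - energy m n x w \<le> g * \<eta>"
        show "packing_number W (euclid_dist n) \<epsilon> \<le> enat N"
          by (rule *[OF **]) (rule W[rule_format])
      qed (rule \<eta>)
      then show ?thesis by blast
    qed
    then obtain N \<eta> where B: "\<And>k. B k (N k) (\<eta> k)" by metis
    have \<eta>: "\<eta> k > 0" for k using B[of k] by (simp add: B_def)
    have packing: "packing_number W (euclid_dist n) \<epsilon> \<le> enat (N k)"
      if "n \<ge> 1" "k \<le> m" "g > 0" "top_energy m n (drop_rows k x) + g \<le> top_energy m n x"
        "\<And>w. w \<in> W \<Longrightarrow> w \<in> half_sphere n \<and> top_energy m n x - energy m n x w \<le> g * \<eta> k"
      for k m n x g W
      using that by (rule B[of k, unfolded B_def, THEN conjunct2, rule_format])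
    have \<kappa>: "\<kappa> \<ge> 0" unfolding \<kappa>_def by (rule Bochner_Integration.integral_nonneg) simp
    have eventually_small: "\<forall>\<^sub>F n in sequentially. b / real n \<le> e" if "e > 0" for b e :: real
    proof -
      have "(\<lambda>n. b / real n) \<longlonglongrightarrow> 0" by (rule lim_const_over_n)
      then have "\<forall>\<^sub>F n in sequentially. b / real n < e" using that by (rule order_tendstoD)
      then show ?thesis by eventually_elim simp
    qed
    \<comment> \<open>Half of \<open>\<delta>\<close> is spent on the failure of the gap; this fixes
      the number of deleted rows independently of \<open>n\<close>.\<close>
    have "\<forall>\<^sub>F k in sequentially. (4 * (\<kappa> + 3 * s2\<^sup>2) / s2\<^sup>2) / real k \<le> \<delta> / 2 \<and> k \<ge> 1"
      by (intro eventually_conj eventually_ge_at_top eventually_small) (use \<delta> in simp)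
    then obtain k where k: "(4 * (\<kappa> + 3 * s2\<^sup>2) / s2\<^sup>2) / real k \<le> \<delta> / 2" "k \<ge> 1"
      using eventually_happens' sequentially_bot by blast
    define g where "g = k * s2 / 2"
    have g: "g > 0" using k s2_pos by (simp add: g_def)
    \<comment> \<open>With \<open>c = \<tau>\<^sup>2\<close> the cost term of \<open>U_le\<close> is
      \<open>4 * (s2 + 2) * \<tau> / (\<epsilon> * (g * \<eta> k))\<close>, and this choice of
      \<open>\<tau>\<close> makes it the other half of \<open>\<delta>\<close>.\<close>
    define \<tau> where "\<tau> = \<delta> * (\<epsilon> * (g * \<eta> k)) / (8 * (s2 + 2))"
    have \<tau>: "\<tau> > 0" using \<delta> \<epsilon> g \<eta> s2_pos by (simp add: \<tau>_def)
    have \<tau>_eq: "(2 * \<tau> * s2 + 4 * \<tau>\<^sup>2 / \<tau>) * (2 / (\<epsilon> * (g * \<eta> k))) = \<delta> / 2"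
    proof -
      have 1: "2 * \<tau> * s2 + 4 * \<tau>\<^sup>2 / \<tau> = 2 * (s2 + 2) * \<tau>"
        using \<tau> by (simp add: power2_eq_square algebra_simps)
      have 2: "2 * r * (\<delta> * q / (8 * r)) * (2 / q) = \<delta> / 2" if "q > 0" "r > 0" for q r :: real
        using that by simp
      show ?thesis
        unfolding 1 unfolding \<tau>_def by (rule 2) (use \<epsilon> g \<eta>[of k] s2_pos in simp_all)
    qed
    \<comment> \<open>Half of the square of \<open>c = \<tau>\<^sup>2\<close> that
      \<open>integral_top_energy_le'\<close> allows; the other half is left to
      \<open>\<kappa> / n\<close>.\<close>
    have "\<forall>\<^sub>F i in sequentially. s2\<^sup>2 / real i \<le> (\<tau>\<^sup>2)\<^sup>2 / 2"
      using \<tau> by (intro eventually_small) simp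
    then obtain m0 where m0: "\<And>i. i \<ge> m0 \<Longrightarrow> s2\<^sup>2 / real i \<le> (\<tau>\<^sup>2)\<^sup>2 / 2"
      unfolding eventually_sequentially by blast
    define m1 where "m1 = max m0 k"
    \<comment> \<open>The bound must not depend on \<open>n\<close>: \<open>N k\<close> serves
      \<open>m n \<ge> m1\<close>, and \<open>N i\<close> serves \<open>m n = i < m1\<close>. The
      sum dominates all of them.\<close>
    define N' where "N' = N k + (\<Sum>i<m1. N i)"
    have N_le: "N k \<le> N'" "\<And>i. i < m1 \<Longrightarrow> N i \<le> N'"
      unfolding N'_def by (auto intro!: trans_le_add2 member_le_sum)
    have "\<forall>\<^sub>F n in sequentially. \<kappa> / real n \<le> (\<tau>\<^sup>2)\<^sup>2 / 2"
      using \<tau> by (intro eventually_small) simp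
    moreover have "\<forall>\<^sub>F n in sequentially. (4 * \<kappa> / s2\<^sup>2) / real n \<le> \<delta> / 2"
      using \<delta> by (intro eventually_small) simp
    \<comment> \<open>This is the cost term in the case of few rows, with \<open>\<tau> = 1\<close>,
      \<open>c = s2\<close> and \<open>g = n * s2 / 2\<close>. It is small uniformly over the
      finitely many row numbers below \<open>m1\<close>.\<close>
    moreover have "\<forall>\<^sub>F n in sequentially. \<forall>i\<in>{..<m1}. (24 / (\<epsilon> * \<eta> i)) / real n \<le> \<delta> / 2"
      using \<delta> by (intro eventually_ball_finite ballI eventually_small) simp_all
    moreover have "\<forall>\<^sub>F n in sequentially. n \<ge> (1 :: nat)" by (rule eventually_ge_at_top)
    ultimately have "\<forall>\<^sub>F n in sequentially. U \<epsilon> n N' \<le> ennreal \<delta>"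
    proof eventually_elim
      case (elim n)
      note n = elim(4)
      show ?case
      proof (cases "m n \<ge> m1")
        case True
        then have km: "k \<le> m n" by (simp add: m1_def)
        have "U \<epsilon> n N' \<le> ennreal (\<delta> / 2 + (2 * \<tau> * s2 + 4 * \<tau>\<^sup>2 / \<tau>) * (2 / (\<epsilon> * (g * \<eta> k))))"
        proof (rule U_le[OF n \<epsilon> \<eta>[of k] g \<tau>, of "\<delta> / 2" "\<tau>\<^sup>2" k N'])
          fix x W
          assume *: "top_energy (m n) n (drop_rows k x) + g \<le> top_energy (m n) n x"
            "\<And>w. w \<in> W \<Longrightarrow> w \<in> half_sphere n \<and> top_energy (m n) n x - energy (m n) n x w \<le> g * \<eta> k"
          have "packing_number W (euclid_dist n) \<epsilon> \<le> enat (N k)"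
            by (rule packing[OF n km g *])
          then show "packing_number W (euclid_dist n) \<epsilon> \<le> enat N'"
            using N_le(1) by (meson enat_ord_simps(1) order_trans)
        next
          show "emeasure (law (m n) n) {x \<in> space (law (m n) n). top_energy (m n) n x < top_energy (m n) n (drop_rows k x) + g}
              \<le> ennreal (\<delta> / 2)"
            unfolding g_def
            by (rule order_trans[OF drop_rows_gap(2)[OF n k(2) km]])
              (use k(1) in \<open>auto intro!: ennreal_leI simp: mult.commute\<close>)
          show "{x \<in> space (law (m n) n). top_energy (m n) n x < top_energy (m n) n (drop_rows k x) + g} \<in> sets (law (m n) n)"
            unfolding g_def by (rule drop_rows_gap(1)[OF n k(2) km])
          have "s2\<^sup>2 / real (m n) \<le> (\<tau>\<^sup>2)\<^sup>2 / 2" using m0 True by (simp add: m1_def)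
          with elim(1) have "s2\<^sup>2 / real (m n) + \<kappa> / real n \<le> (\<tau>\<^sup>2)\<^sup>2" by linarith
          then show "(\<integral>x. top_energy (m n) n x \<partial>law (m n) n) \<le> \<tau>\<^sup>2 * (real (m n) * real n)"
            using \<tau> by (intro integral_top_energy_le' n m_pos) auto
        qed (use \<delta> in auto)
        then show ?thesis unfolding \<tau>_eq by simp
      next
        case False
        define g where "g = n * s2 / 2"
        have g: "g > 0" using n s2_pos by (simp add: g_def)
        have "U \<epsilon> n N' \<le> ennreal (\<delta> / 2 + (2 * 1 * s2 + 4 * s2 / 1) * (2 / (\<epsilon> * (g * \<eta> (m n)))))"
        \<comment> \<open>The average cost need not become small here, but the tolerated loss grows
          with \<open>n\<close>, so the crude values \<open>\<tau> = 1\<close> and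
          \<open>c = s2\<close> suffice.\<close>
        proof (rule U_le[OF n \<epsilon> \<eta>[of "m n"] g zero_less_one, of "\<delta> / 2" s2 "m n" N'])
          fix x W
          assume *: "top_energy (m n) n (drop_rows (m n) x) + g \<le> top_energy (m n) n x"
            "\<And>w. w \<in> W \<Longrightarrow> w \<in> half_sphere n \<and> top_energy (m n) n x - energy (m n) n x w \<le> g * \<eta> (m n)"
          have "packing_number W (euclid_dist n) \<epsilon> \<le> enat (N (m n))"
            by (rule packing[OF n order_refl g *])
          then show "packing_number W (euclid_dist n) \<epsilon> \<le> enat N'"
            using N_le(2)[of "m n"] False by (meson enat_ord_simps(1) order_trans not_le)
        next
          show "emeasure (law (m n) n) {x \<in> space (law (m n) n). top_energy (m n) n x < top_energy (m n) n (drop_rows (m n) x) + g}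
              \<le> ennreal (\<delta> / 2)"
            unfolding g_def
            by (rule order_trans[OF drop_all_rows_gap(2)[OF n m_pos[OF n]]])
              (use elim(2) in \<open>auto intro!: ennreal_leI simp: mult.commute\<close>)
          show "{x \<in> space (law (m n) n). top_energy (m n) n x < top_energy (m n) n (drop_rows (m n) x) + g} \<in> sets (law (m n) n)"
            unfolding g_def by (rule drop_all_rows_gap(1)[OF n m_pos[OF n]])
          show "(\<integral>x. top_energy (m n) n x \<partial>law (m n) n) \<le> s2 * (real (m n) * real n)"
            by (rule integral_top_energy_le[OF n])
        qed (use \<delta> s2_pos in auto)
        also have "(2 * 1 * s2 + 4 * s2 / 1) * (2 / (\<epsilon> * (g * \<eta> (m n)))) = (24 / (\<epsilon> * \<eta> (m n))) / real n"
          using s2_pos n \<epsilon> \<eta>[of "m n"] by (simp add: g_def field_simps)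
        also have "ennreal (\<delta> / 2 + (24 / (\<epsilon> * \<eta> (m n))) / real n) \<le> ennreal (\<delta> / 2 + \<delta> / 2)"
          using elim(3) False by (intro ennreal_leI add_left_mono) auto
        finally show ?thesis by simp
      qed
    qed
    then show ?thesis by (intro exI[of _ N'] Limsup_bounded)
  qed
  then show ?thesis
    unfolding stable_under_small_perturbations_def U_def
    by (auto simp: perturbation_blocks_def I_eq)
qed

end
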